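(* Let $a,b>-1$ be fixed and let $c\in[0,\infty)$. For each $N\ge 1$ let $\beta=\beta_N>0$ and let $(\lambda_1,\dots,\lambda_N)\in(0,1)^N$ be random with the beta Jacobi ensemble joint density $$\frac{1}{Z_N}\prod_{1\le i<j\le N}|\lambda_j-\lambda_i|^{\beta}\prod_{l=1}^N\lambda_l^a(1-\lambda_l)^b,\qquad \lambda_i\in(0,1),$$ where $Z_N$ is the normalizing constant (all ensembles being defined on a common probability space). Let $L_N=\frac1N\sum_{i=1}^N\delta_{\lambda_i}$ be the empirical distribution. If $N\to\infty$ and $\beta N\to 2c$, then almost surely $L_N$ converges weakly to the probability measure $\nu_{a,b,c}$, where $\nu_{a,b,c}$ is the spectral measure of the infinite Jacobi matrix $$J_c=\begin{pmatrix}\sqrt{\hat\lambda_0(c)}\\ \sqrt{\mu_1(c)}&\sqrt{\lambda_1(c)}\\ &\sqrt{\mu_2(c)}&\sqrt{\lambda_2(c)}\\ &&\ddots&\ddots\end{pmatrix}\begin{pmatrix}\sqrt{\hat\lambda_0(c)}&\sqrt{\mu_1(c)}\\ &\sqrt{\lambda_1(c)}&\sqrt{\mu_2(c)}\\ &&\sqrt{\lambda_2(c)}&\ddots\\&&&\ddots\end{pmatrix}$$ with $$\hat\lambda_0(c)=\frac{c+a+1}{2c+a+b+2},\qquad \lambda_n(c)=\frac{n+c+a+1}{2n+2c+a+b+2}\cdot\frac{n+c+a+b+1}{2n+2c+a+b+1}\quad(n\ge1),$$ $$\mu_n(c)=\frac{n+c}{2n+2c+a+b+1}\cdot\frac{n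+c+b}{2n+2c+a+b}\quad(n\ge1).$$
   Context: $\delta_\lambda$ denotes the Dirac measure at $\lambda$. A Jacobi matrix is an infinite symmetric tridiagonal real matrix $J$ indexed by $\{1,2,\dots\}$ with positive off-diagonal entries. When the entries are bounded (as here), its spectral measure is the unique probability measure $\mu$ on $\mathbb R$ with $\int x^k\,d\mu(x)=J^k(1,1)$ for all $k=0,1,2,\dots$, where $J^k(1,1)$ is the $(1,1)$ entry of $J^k$. Explicitly, $J_c$ has diagonal entries $\hat\lambda_0,\ \lambda_1+\mu_1,\ \lambda_2+\mu_2,\dots$ and off-diagonal entries $\sqrt{\hat\lambda_0\mu_1},\sqrt{\lambda_1\mu_2},\sqrt{\lambda_2\mu_3},\dots$. *)

theory Defs
  imports "HOL-Probability.Probability"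
begin

section \<open>The beta Jacobi ensemble\<close>

text \<open>
  Vectors in \<open>\<real>\<^sup>N\<close> are represented by functions on \<open>{1..N}\<close>, that is, elements of the product
  space \<open>\<Pi>\<^sub>M i\<in>{1..N}. lborel\<close>.
\<close>

definition beta_jacobi_weight :: "real \<Rightarrow> real \<Rightarrow> real \<Rightarrow> nat \<Rightarrow> (nat \<Rightarrow> real) \<Rightarrow> real" where
  "beta_jacobi_weight a b \<beta> N x =
     (if \<forall>i\<in>{1..N}. 0 < x i \<and> x i < 1
      then (\<Prod>j\<in>{1..N}. \<Prod>i\<in>{1..<j}. \<bar>x j - x i\<bar> powr \<beta>) *
           (\<Prod>l\<in>{1..N}. x l powr a * (1 - x l) powr b)
      else 0)"

definition beta_jacobi_Z :: "real \<Rightarrow> real \<Rightarrow> real \<Rightarrow> nat \<Rightarrow> ennreal" where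
  "beta_jacobi_Z a b \<beta> N =
     (\<integral>\<^sup>+x. ennreal (beta_jacobi_weight a b \<beta> N x) \<partial>(\<Pi>\<^sub>M i\<in>{1..N}. lborel))"

definition beta_jacobi_density :: "real \<Rightarrow> real \<Rightarrow> real \<Rightarrow> nat \<Rightarrow> (nat \<Rightarrow> real) \<Rightarrow> ennreal" where
  "beta_jacobi_density a b \<beta> N x =
     ennreal (beta_jacobi_weight a b \<beta> N x) / beta_jacobi_Z a b \<beta> N"

lemma beta_jacobi_weight_measurable:
  "beta_jacobi_weight a b \<beta> N \<in> borel_measurable (\<Pi>\<^sub>M i\<in>{1..N}. lborel)"
  unfolding beta_jacobi_weight_def by measurable

definition empirical_measure :: "nat \<Rightarrow> (nat \<Rightarrow> real) \<Rightarrow> real measure" where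
  "empirical_measure N x =
     measure_of UNIV (sets borel) (\<lambda>A. (\<Sum>i\<in>{1..N}. emeasure (return borel (x i)) A) / of_nat N)"

lemma sets_empirical_measure [simp]: "sets (empirical_measure N x) = sets borel"
  and space_empirical_measure [simp]: "space (empirical_measure N x) = UNIV"
  unfolding empirical_measure_def
  using sets.sigma_sets_eq[of "borel :: real measure"] by simp_all

lemma emeasure_empirical_measure:
  assumes "A \<in> sets borel"
  shows "emeasure (empirical_measure N x) A =
           (\<Sum>i\<in>{1..N}. emeasure (return borel (x i)) A) / of_nat N"
proof (rule emeasure_measure_of[OF empirical_measure_def])
  show "countably_additive (sets (empirical_measure N x))
          (\<lambda>A. (\<Sum>i\<in>{1..N}. emeasure (return borel (x i)) A) / of_nat N)"
  proof (rule countably_additiveI)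
    fix F :: "nat \<Rightarrow> real set"
    assume F: "range F \<subseteq> sets (empirical_measure N x)" "disjoint_family F"
    have "(\<Sum>n. emeasure (return borel (x i)) (F n)) = emeasure (return borel (x i)) (\<Union> (range F))" for i
      using F by (intro suminf_emeasure) auto
    then show "(\<Sum>n. (\<Sum>i\<in>{1..N}. emeasure (return borel (x i)) (F n)) / of_nat N) =
               (\<Sum>i\<in>{1..N}. emeasure (return borel (x i)) (\<Union> (range F))) / of_nat N"
      by (simp add: ennreal_suminf_divide suminf_sum)
  qed
qed (use assms in \<open>auto simp: positive_def\<close>)

section \<open>Infinite matrices and spectral measures\<close>

text \<open>
  Rows and columns are numbered from 0, so that the \<open>(1,1)\<close> entry of the usual numbering is the
  entry at \<open>0 0\<close>. For banded matrices the sum in the product has finite support.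
\<close>

type_synonym imatrix = "nat \<Rightarrow> nat \<Rightarrow> real"

definition imat_mult :: "imatrix \<Rightarrow> imatrix \<Rightarrow> imatrix" where
  "imat_mult A B = (\<lambda>i j. \<Sum>\<^sub>\<infinity>k. A i k * B k j)"

definition imat_transpose :: "imatrix \<Rightarrow> imatrix" where
  "imat_transpose A = (\<lambda>i j. A j i)"

primrec imat_power :: "imatrix \<Rightarrow> nat \<Rightarrow> imatrix" where
  "imat_power A 0 = (\<lambda>i j. if i = j then 1 else 0)"
| "imat_power A (Suc k) = imat_mult A (imat_power A k)"

definition is_spectral_measure :: "imatrix \<Rightarrow> real measure \<Rightarrow> bool" where
  "is_spectral_measure J \<mu> \<longleftrightarrow>
     real_distribution \<mu> \<and> (\<forall>k. has_bochner_integral \<mu> (\<lambda>x. x ^ k) (imat_power J k 0 0))"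

definition spectral_measure :: "imatrix \<Rightarrow> real measure" where
  "spectral_measure J = (THE \<mu>. is_spectral_measure J \<mu>)"

section \<open>The limiting measure\<close>

definition hat_lambda0 :: "real \<Rightarrow> real \<Rightarrow> real \<Rightarrow> real" where
  "hat_lambda0 a b c = (c + a + 1) / (2 * c + a + b + 2)"

definition lambda_coeff :: "real \<Rightarrow> real \<Rightarrow> real \<Rightarrow> nat \<Rightarrow> real" where
  "lambda_coeff a b c n =
     (real n + c + a + 1) / (2 * real n + 2 * c + a + b + 2) *
     ((real n + c + a + b + 1) / (2 * real n + 2 * c + a + b + 1))"

definition mu_coeff :: "real \<Rightarrow> real \<Rightarrow> real \<Rightarrow> nat \<Rightarrow> real" where
  "mu_coeff a b c n =
     (real n + c) / (2 * real n + 2 * c + a + b + 1) *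
     ((real n + c + b) / (2 * real n + 2 * c + a + b))"

text \<open>The lower bidiagonal factor of \<open>J\<^sub>c\<close>.\<close>

definition jacobi_factor :: "real \<Rightarrow> real \<Rightarrow> real \<Rightarrow> imatrix" where
  "jacobi_factor a b c = (\<lambda>i j.
     if i = j then sqrt (if i = 0 then hat_lambda0 a b c else lambda_coeff a b c i)
     else if i = Suc j then sqrt (mu_coeff a b c i)
     else 0)"

definition J_mat :: "real \<Rightarrow> real \<Rightarrow> real \<Rightarrow> imatrix" where
  "J_mat a b c = imat_mult (jacobi_factor a b c) (imat_transpose (jacobi_factor a b c))"

definition nu_measure :: "real \<Rightarrow> real \<Rightarrow> real \<Rightarrow> real measure" where
  "nu_measure a b c = spectral_measure (J_mat a b c)"

text \<open>The factorisation has the expected tridiagonal product.\<close>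

lemma J_mat_entries:
  assumes "a > -1" "b > -1" "c \<ge> 0"
  shows "J_mat a b c 0 0 = hat_lambda0 a b c"
    and "n \<ge> 1 \<Longrightarrow> J_mat a b c n n = lambda_coeff a b c n + mu_coeff a b c n"
    and "J_mat a b c 0 1 = sqrt (hat_lambda0 a b c * mu_coeff a b c 1)"
    and "n \<ge> 1 \<Longrightarrow> J_mat a b c n (Suc n) = sqrt (lambda_coeff a b c n * mu_coeff a b c (Suc n))"
    and "J_mat a b c i j = J_mat a b c j i"
    and "Suc i < j \<Longrightarrow> J_mat a b c i j = 0"
proof -
  let ?L = "jacobi_factor a b c"
  have fin: "J_mat a b c i j = (\<Sum>k\<in>{i - 1..i}. ?L i k * ?L j k)" for i j
  proof -
    have "J_mat a b c i j = (\<Sum>\<^sub>\<infinity>k\<in>{i - 1..i}. ?L i k * ?L j k)"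
      unfolding J_mat_def imat_mult_def imat_transpose_def
      by (rule infsum_cong_neutral) (auto simp: jacobi_factor_def)
    then show ?thesis by simp
  qed
  have iv: "{m..Suc m} = {m, Suc m}" for m :: nat by auto
  have h0: "hat_lambda0 a b c \<ge> 0" using assms by (simp add: hat_lambda0_def)
  have l0: "lambda_coeff a b c n \<ge> 0" if "n \<ge> 1" for n
  proof -
    have "real n \<ge> 1" using that by simp
    then show ?thesis using assms unfolding lambda_coeff_def
      by (intro mult_nonneg_nonneg divide_nonneg_nonneg) auto
  qed
  have m0: "mu_coeff a b c n \<ge> 0" if "n \<ge> 1" for n
  proof -
    have "real n \<ge> 1" using that by simp
    then show ?thesis using assms unfolding mu_coeff_def
      by (intro mult_nonneg_nonneg divide_nonneg_nonneg) auto
  qed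
  show "J_mat a b c 0 0 = hat_lambda0 a b c"
    using h0 by (simp add: fin jacobi_factor_def)
  show "J_mat a b c n n = lambda_coeff a b c n + mu_coeff a b c n" if "n \<ge> 1"
    using that l0[OF that] m0[OF that] by (cases n) (simp_all add: fin iv jacobi_factor_def)
  show "J_mat a b c 0 1 = sqrt (hat_lambda0 a b c * mu_coeff a b c 1)"
    by (simp add: fin jacobi_factor_def real_sqrt_mult)
  show "J_mat a b c n (Suc n) = sqrt (lambda_coeff a b c n * mu_coeff a b c (Suc n))" if "n \<ge> 1"
    using that by (cases n) (simp_all add: fin iv jacobi_factor_def real_sqrt_mult)
  show "J_mat a b c i j = J_mat a b c j i"
    unfolding J_mat_def imat_mult_def imat_transpose_def by (simp add: mult.commute)
  show "J_mat a b c i j = 0" if "Suc i < j"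
    using that by (auto simp: fin jacobi_factor_def intro!: sum.neutral)
qed

end

theory Submission
  imports Defs
begin

text \<open>
  Put \<open>\<phi>\<^sub>s(x) = x + s x\<^sup>k\<^sup>+\<^sup>1 (1 - x)\<close>, which for small \<open>s\<close> is a diffeomorphism of \<open>[0, 1]\<close>. Applying it to all
  coordinates multiplies the density of the ensemble (Jacobian included) by a factor that is at least
  \<open>exp (s N D\<^sub>k - O(N s\<^sup>2))\<close>, where \<open>D\<^sub>k\<close> is the random variable of the \<open>k\<close>-th loop equation, a polynomial
  in the power means \<open>S\<^sub>p = \<integral> x\<^sup>p dL\<^sub>N\<close>. Since the total mass is preserved, \<open>E exp (s N D\<^sub>k) \<le> exp (O(N s\<^sup>2))\<close>,
  so that \<open>D\<^sub>k \<rightarrow> 0\<close> almost surely by Borel--Cantelli.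

  In the limit these equations determine the moments \<open>m\<^sub>k\<close> recursively. Equivalently, \<open>F = \<Sum> m\<^sub>k t\<^sup>k\<close> solves
  a Riccati equation. Writing \<open>F = 1 / (1 - \<alpha>\<^sub>1 t F\<^sub>1)\<close>, \<open>F\<^sub>1 = 1 / (1 - \<alpha>\<^sub>2 t F\<^sub>2)\<close>, and so on, each \<open>F\<^sub>n\<close> solves a
  Riccati equation of the same shape, and the normalisation \<open>F\<^sub>n(0) = 1\<close> gives the \<open>\<alpha>\<^sub>n\<close>: these are the
  squared entries of the bidiagonal factor of \<open>J\<^sub>c\<close>. Hence \<open>m\<^sub>k = J\<^sub>c\<^sup>k(1,1)\<close>.

  All measures live on \<open>[0, 1]\<close>, so convergence of moments yields both the existence of the
  spectral measure (Helly selection along one sample point) and weak convergence to it.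
\<close>

section \<open>Convergence of moments on the unit interval\<close>

text \<open>Moments bounded by 1 make the Taylor series of the characteristic function converge
  everywhere, so they determine it; Levy's uniqueness theorem then applies.\<close>

lemma real_distribution_eq_of_moments:
  assumes \<mu>: "\<And>k. has_bochner_integral \<mu> (\<lambda>x. x ^ k) (m k)" "real_distribution \<mu>"
    and \<nu>: "\<And>k. has_bochner_integral \<nu> (\<lambda>x. x ^ k) (m k)" "real_distribution \<nu>"
    and bound: "\<And>k. m k \<le> 1"
  shows "\<mu> = \<nu>"
proof -
  \<comment> \<open>Partial sums of even order suffice, and for them the absolute moment in the
    Taylor remainder is the moment \<open>m (2 * n)\<close> itself.\<close>
  have lim: "(\<lambda>n. \<Sum>k\<le>2 * n. ((\<i> * t) ^ k / fact k) * complex_of_real (m k)) \<longlonglongrightarrow> char \<mu> t"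
    if mom: "\<And>k. has_bochner_integral \<mu> (\<lambda>x. x ^ k) (m k)" and rd: "real_distribution \<mu>"
    for \<mu> and t :: real
  proof (rule Lim_null[THEN iffD2], rule Lim_null_comparison)
    interpret real_distribution \<mu> by (rule rd)
    note int = mom[THEN integrable.intros] and val = mom[THEN has_bochner_integral_integral_eq]
    have "(\<lambda>n. \<bar>t\<bar> ^ n / fact n) \<longlonglongrightarrow> 0"
      using summable_LIMSEQ_zero[OF summable_exp_generic[of "\<bar>t\<bar>"]]
      by (simp add: divide_inverse mult.commute)
    then have "((\<lambda>n. \<bar>t\<bar> ^ n / fact n) \<circ> (\<lambda>n. 2 * n)) \<longlonglongrightarrow> 0"
      by (rule LIMSEQ_subseq_LIMSEQ) (simp add: strict_mono_def)
    from tendsto_mult[OF tendsto_const[of 2] this]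
    show "(\<lambda>n. 2 * (\<bar>t\<bar> ^ (2 * n) / fact (2 * n))) \<longlonglongrightarrow> 0"
      by (simp only: comp_def mult_zero_right)
    show "\<forall>\<^sub>F n in sequentially. norm ((\<Sum>k\<le>2 * n. ((\<i> * t) ^ k / fact k) * complex_of_real (m k)) - char \<mu> t)
            \<le> 2 * (\<bar>t\<bar> ^ (2 * n) / fact (2 * n))"
    proof (intro always_eventually allI)
      fix n
      have "norm (char \<mu> t - (\<Sum>k\<le>2 * n. ((\<i> * t) ^ k / fact k) * complex_of_real (m k)))
          \<le> (2 * \<bar>t\<bar> ^ (2 * n) / fact (2 * n)) * expectation (\<lambda>x. \<bar>x\<bar> ^ (2 * n))"
        using char_approx1[where n = "2 * n" and t = t, OF int] unfolding val by simp
      also have "expectation (\<lambda>x. \<bar>x\<bar> ^ (2 * n)) = m (2 * n)"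
        using val[of "2 * n"] by (simp only: power_even_abs even_mult_iff even_numeral simp_thms)
      also have "(2 * \<bar>t\<bar> ^ (2 * n) / fact (2 * n)) * m (2 * n) \<le> (2 * \<bar>t\<bar> ^ (2 * n) / fact (2 * n)) * 1"
        by (intro mult_left_mono bound) simp
      finally show "norm ((\<Sum>k\<le>2 * n. ((\<i> * t) ^ k / fact k) * complex_of_real (m k)) - char \<mu> t)
            \<le> 2 * (\<bar>t\<bar> ^ (2 * n) / fact (2 * n))"
        by (simp add: norm_minus_commute)
    qed
  qed
  have "char \<mu> = char \<nu>"
    using LIMSEQ_unique[OF lim[OF \<mu>] lim[OF \<nu>]] by auto
  then show ?thesis
    using Levy_uniqueness[OF \<mu>(2) \<nu>(2)] by blast
qed

text \<open>Powers are unbounded on the real line, so weak convergence is applied to powers of the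
  clamp \<open>cl\<close> onto [0, 1]. It agrees with the identity almost everywhere under each
  \<open>\<mu> n\<close> and, as has to be shown, under \<open>\<nu>\<close>.\<close>

lemma weak_limit_moments_unit_interval:
  assumes rd: "\<And>n. real_distribution (\<mu> n)" and supp: "\<And>n. AE x in \<mu> n. x \<in> {0..1}"
    and mom: "\<And>k. (\<lambda>n. integral\<^sup>L (\<mu> n) (\<lambda>x. x ^ k)) \<longlonglongrightarrow> m k"
    and \<nu>: "real_distribution \<nu>" "weak_conv_m \<mu> \<nu>"
  shows "has_bochner_integral \<nu> (\<lambda>x. x ^ k) (m k)"
proof -
  interpret \<nu>: real_distribution \<nu> by fact
  interpret \<mu>: real_distribution "\<mu> n" for n by fact
  define cl where "cl x = max 0 (min 1 x)" for x :: real
  have cl_cont: "isCont cl x" for x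
    unfolding cl_def by (intro continuous_intros)
  have cl_meas [measurable]: "cl \<in> borel_measurable borel"
    unfolding cl_def by measurable
  have cl_mem: "0 \<le> cl x" "cl x \<le> 1" for x by (auto simp: cl_def)
  have cl_eq: "x \<in> {0..1} \<Longrightarrow> cl x = x" for x by (auto simp: cl_def)
  \<comment> \<open>\<open>\<bar>x - cl x\<bar>\<close> is the distance to [0, 1]. Truncated, it is
    a bounded continuous test function whose vanishing integral puts \<open>\<nu>\<close> on
    [0, 1].\<close>
  have "(\<lambda>n. integral\<^sup>L (\<mu> n) (\<lambda>x. min 1 \<bar>x - cl x\<bar>)) \<longlonglongrightarrow> integral\<^sup>L \<nu> (\<lambda>x. min 1 \<bar>x - cl x\<bar>)"
    by (intro weak_conv_imp_integral_bdd_continuous_conv[OF rd \<nu>, where B = 1] continuous_intros cl_cont) auto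
  moreover have "integral\<^sup>L (\<mu> n) (\<lambda>x. min 1 \<bar>x - cl x\<bar>) = 0" for n
    using supp[of n] by (intro integral_eq_zero_AE) (auto simp: cl_eq)
  ultimately have "integral\<^sup>L \<nu> (\<lambda>x. min 1 \<bar>x - cl x\<bar>) = 0"
    by (simp add: LIMSEQ_const_iff)
  moreover have "integrable \<nu> (\<lambda>x. min 1 \<bar>x - cl x\<bar>)"
    by (rule \<nu>.integrable_const_bound[where B = 1]) auto
  ultimately have "AE x in \<nu>. min 1 \<bar>x - cl x\<bar> = 0"
    by (subst (asm) integral_nonneg_eq_0_iff_AE) auto
  then have AE: "AE x in \<nu>. cl x ^ k = x ^ k"
    by (elim eventually_mono) (auto simp: min_def split: if_splits)
  have "(\<lambda>n. integral\<^sup>L (\<mu> n) (\<lambda>x. cl x ^ k)) \<longlonglongrightarrow> integral\<^sup>L \<nu> (\<lambda>x. cl x ^ k)"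
    by (intro weak_conv_imp_integral_bdd_continuous_conv[OF rd \<nu>, where B = 1] continuous_intros cl_cont)
       (auto simp: cl_mem power_le_one)
  moreover have "integral\<^sup>L (\<mu> n) (\<lambda>x. cl x ^ k) = integral\<^sup>L (\<mu> n) (\<lambda>x. x ^ k)" for n
    using supp[of n] by (intro integral_cong_AE) (auto simp: cl_eq)
  ultimately have "integral\<^sup>L \<nu> (\<lambda>x. cl x ^ k) = m k"
    using mom[of k] LIMSEQ_unique by simp
  moreover have "integrable \<nu> (\<lambda>x. cl x ^ k)"
    by (rule \<nu>.integrable_const_bound[where B = 1]) (auto simp: cl_mem power_le_one)
  ultimately have "has_bochner_integral \<nu> (\<lambda>x. cl x ^ k) (m k)"
    by (simp add: has_bochner_integral_iff)
  then show ?thesis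
    using has_bochner_integral_cong_AE[OF _ _ AE] by auto
qed

lemma tight_unit_interval:
  assumes rd: "\<And>n. real_distribution (\<mu> n)" and supp: "\<And>n. AE x in \<mu> n. x \<in> {0..1}"
  shows "tight \<mu>"
  unfolding tight_def
proof (intro conjI allI impI)
  fix \<epsilon> :: real assume "\<epsilon> > 0"
  interpret \<mu>: real_distribution "\<mu> n" for n by fact
  \<comment> \<open>\<open>tight\<close> uses intervals open on the left, and 0 may carry mass;
    hence a left end below 0.\<close>
  have "measure (\<mu> n) {-1<..1} = 1" for n
  proof -
    have "AE x in \<mu> n. x \<in> {-1<..1}"
      using supp[of n] by (elim eventually_mono) auto
    then show ?thesis
      by (subst \<mu>.prob_eq_1) auto
  qed
  then show "\<exists>a b. a < b \<and> (\<forall>n. 1 - \<epsilon> < measure (\<mu> n) {a<..b})"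
    using \<open>\<epsilon> > 0\<close> by (intro exI[of _ "-1"] exI[of _ 1]) auto
qed (rule rd)

text \<open>\<open>spectral_measure\<close> is a definite description, so existence and uniqueness
  come first. Tightness gives a weakly convergent subsequence; any such limit has the prescribed
  moments, and these identify it. All subsequential limits agree, hence the full sequence
  converges.\<close>

lemma moment_convergence_unit_interval:
  assumes rd: "\<And>n. real_distribution (\<mu> n)" and supp: "\<And>n. AE x in \<mu> n. x \<in> {0..1}"
    and mom: "\<And>k. (\<lambda>n. integral\<^sup>L (\<mu> n) (\<lambda>x. x ^ k)) \<longlonglongrightarrow> imat_power J k 0 0"
  shows "is_spectral_measure J (spectral_measure J)" "weak_conv_m \<mu> (spectral_measure J)"
proof -
  let ?m = "\<lambda>k. imat_power J k 0 0"
  note tight = tight_unit_interval[of \<mu>, OF rd supp]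
  have bound: "?m k \<le> 1" for k
  proof (rule LIMSEQ_le_const2[OF mom], intro exI allI impI)
    fix n
    interpret real_distribution "\<mu> n" by fact
    have "(\<integral>x. x ^ k \<partial>\<mu> n) \<le> (\<integral>x. 1 \<partial>\<mu> n)"
    proof (rule integral_mono_AE)
      show "integrable (\<mu> n) (\<lambda>x. x ^ k)"
        using supp[of n] by (intro integrable_const_bound[where B = 1]) (auto simp: power_le_one)
      show "AE x in \<mu> n. x ^ k \<le> 1"
        using supp[of n] by (elim eventually_mono) (auto simp: power_le_one)
    qed simp
    then show "(\<integral>x. x ^ k \<partial>\<mu> n) \<le> 1" using prob_space by simp
  qed
  have lim: "is_spectral_measure J \<nu>"
    if "strict_mono s" "real_distribution \<nu>" "weak_conv_m (\<mu> \<circ> s) \<nu>" for s \<nu>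
    unfolding is_spectral_measure_def
  proof (intro conjI allI weak_limit_moments_unit_interval[where \<mu> = "\<mu> \<circ> s"])
    show "(\<lambda>n. integral\<^sup>L ((\<mu> \<circ> s) n) (\<lambda>x. x ^ k)) \<longlonglongrightarrow> ?m k" for k
      using LIMSEQ_subseq_LIMSEQ[OF mom that(1)] by (simp add: comp_def)
  qed (use that rd supp in \<open>simp_all only: comp_apply\<close>)
  have uniq: "\<nu> = \<nu>'" if "is_spectral_measure J \<nu>" "is_spectral_measure J \<nu>'" for \<nu> \<nu>'
    using that bound unfolding is_spectral_measure_def by (intro real_distribution_eq_of_moments) auto
  obtain r \<nu> where "strict_mono (r :: nat \<Rightarrow> nat)" "real_distribution \<nu>" "weak_conv_m (\<mu> \<circ> r) \<nu>"
    using tight_imp_convergent_subsubsequence[OF tight, of id] by (auto simp: strict_mono_id)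
  then have \<nu>: "is_spectral_measure J \<nu>" by (rule lim)
  then have eq: "spectral_measure J = \<nu>"
    unfolding spectral_measure_def using uniq by (intro the_equality) auto
  show "is_spectral_measure J (spectral_measure J)"
    by (simp add: eq \<nu>)
  show "weak_conv_m \<mu> (spectral_measure J)"
    unfolding eq
  proof (rule tight_subseq_weak_converge[OF rd _ tight])
    show "real_distribution \<nu>" by fact
  next
    fix s \<nu>'
    assume s: "strict_mono s" "real_distribution \<nu>'" "weak_conv_m (\<mu> \<circ> s) \<nu>'"
    have "\<nu>' = \<nu>" by (rule uniq[OF lim[OF s] \<nu>])
    with s(3) show "weak_conv_m (\<mu> \<circ> s) \<nu>" by simp
  qed
qed

section \<open>The empirical measure as the law of a uniformly chosen coordinate\<close>

lemma empirical_measure_eq_distr: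
  assumes "N \<ge> 1"
  shows "empirical_measure N x = distr (measure_pmf (pmf_of_set {1..N})) borel x"
proof (rule measure_eqI)
  fix A assume "A \<in> sets (empirical_measure N x)"
  then have [measurable]: "A \<in> sets borel" by simp
  have "(\<Sum>i\<in>{1..N}. emeasure (return borel (x i)) A) = of_nat (card ({1..N} \<inter> x -` A))"
    by (simp add: indicator_def sum.If_cases vimage_def)
  also have "\<dots> / of_nat N = ennreal (card ({1..N} \<inter> x -` A) / N)"
    using assms by (simp add: divide_ennreal[symmetric] ennreal_of_nat_eq_real_of_nat)
  finally show "emeasure (empirical_measure N x) A = emeasure (distr (measure_pmf (pmf_of_set {1..N})) borel x) A"
    using assms by (simp add: emeasure_empirical_measure emeasure_distr emeasure_pmf_of_set)
qed simp

lemma real_distribution_empirical_measure: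
  assumes "N \<ge> 1"
  shows "real_distribution (empirical_measure N x)"
proof -
  interpret prob_space "empirical_measure N x"
    unfolding empirical_measure_eq_distr[OF assms] by (rule measure_pmf.prob_space_distr) simp
  show ?thesis by unfold_locales auto
qed

lemma integral_empirical_measure:
  fixes f :: "real \<Rightarrow> real"
  assumes "N \<ge> 1" "f \<in> borel_measurable borel"
  shows "integral\<^sup>L (empirical_measure N x) f = (\<Sum>i\<in>{1..N}. f (x i)) / real N"
  using assms by (simp add: empirical_measure_eq_distr integral_distr integral_pmf_of_set)

lemma AE_empirical_measure:
  assumes "N \<ge> 1" "\<And>i. i \<in> {1..N} \<Longrightarrow> P (x i)" "Measurable.pred borel P"
  shows "AE y in empirical_measure N x. P y"
proof -
  have "{y. P y} \<in> sets borel"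
    using assms(3) by (simp add: pred_def)
  then show ?thesis
    using assms(1,2) unfolding empirical_measure_eq_distr[OF assms(1)]
    by (subst AE_distr_iff) (auto simp: AE_measure_pmf_iff)
qed

section \<open>Jacobi matrices and Stieltjes continued fractions\<close>

text \<open>Entries of even index will give the vector \<open>v\<close> whose coefficients are the
  first columns of the matrix powers; those of odd index give \<open>w = L^T v\<close>.\<close>

definition jacobi_vec :: "(nat \<Rightarrow> real) \<Rightarrow> (nat \<Rightarrow> real fps) \<Rightarrow> nat \<Rightarrow> real fps" where
  "jacobi_vec \<alpha> F n = fps_const (sqrt (\<Prod>i=1..n. \<alpha> i)) * (\<Prod>i\<le>n. F i)"

lemma jacobi_vec_0: "jacobi_vec \<alpha> F 0 = F 0"
  by (simp add: jacobi_vec_def)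

lemma jacobi_vec_Suc:
  "jacobi_vec \<alpha> F (Suc n) = fps_const (sqrt (\<alpha> (Suc n))) * (jacobi_vec \<alpha> F n * F (Suc n))"
  by (simp add: jacobi_vec_def real_sqrt_mult fps_const_mult[symmetric] mult.commute mult.left_commute
        del: fps_const_mult)

text \<open>Multiply the relation for \<open>F (Suc n)\<close> by all earlier factors and split
  \<open>\<alpha> (Suc (Suc n))\<close> into two equal square roots: one stays in front, the other
  is absorbed into \<open>jacobi_vec\<close>.\<close>

lemma jacobi_vec_step:
  assumes "\<And>n. \<alpha> (Suc n) > 0"
    and F: "\<And>n. F n = 1 + fps_const (\<alpha> (Suc n)) * fps_X * F n * F (Suc n)"
  shows "jacobi_vec \<alpha> F (Suc n) = fps_const (sqrt (\<alpha> (Suc n))) * jacobi_vec \<alpha> F n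
           + fps_const (sqrt (\<alpha> (Suc (Suc n)))) * fps_X * jacobi_vec \<alpha> F (Suc (Suc n))"
proof -
  let ?v = "jacobi_vec \<alpha> F n" and ?s = "fps_const (sqrt (\<alpha> (Suc n)))"
    and ?r = "fps_const (sqrt (\<alpha> (Suc (Suc n))))"
  have r: "?r * ?r = fps_const (\<alpha> (Suc (Suc n)))"
    using assms(1)[of "Suc n"] by simp
  have "jacobi_vec \<alpha> F (Suc n) = ?s * (?v * F (Suc n))"
    by (rule jacobi_vec_Suc)
  also have "\<dots> = ?s * (?v * (1 + (?r * ?r) * fps_X * F (Suc n) * F (Suc (Suc n))))"
    using F[of "Suc n"] r by simp
  also have "\<dots> = ?s * ?v + ?r * fps_X * (?r * ((?s * (?v * F (Suc n))) * F (Suc (Suc n))))"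
    by (simp add: algebra_simps del: fps_const_mult)
  finally show ?thesis by (simp add: jacobi_vec_Suc)
qed

text \<open>
  With \<open>v\<^sub>j = t\<^sup>j F\<^sub>0\<cdots>F\<^sub>2\<^sub>j (\<alpha>\<^sub>1\<cdots>\<alpha>\<^sub>2\<^sub>j)\<^sup>1\<^sup>/\<^sup>2\<close> one has \<open>v = e\<^sub>0 + t L L\<^sup>T v\<close> as formal power series, so that
  the coefficients of \<open>v\<close> are the vectors \<open>(L L\<^sup>T)\<^sup>k e\<^sub>0\<close>.
\<close>

lemma tridiagonal_power_00:
  fixes L :: imatrix and \<alpha> :: "nat \<Rightarrow> real" and F :: "nat \<Rightarrow> real fps"
  assumes L: "\<And>i j. L i j = (if i = j then sqrt (\<alpha> (2 * i + 1))
                               else if i = Suc j then sqrt (\<alpha> (2 * i)) else 0)"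
    and pos: "\<And>n. \<alpha> (Suc n) > 0"
    and F: "\<And>n. F n = 1 + fps_const (\<alpha> (Suc n)) * fps_X * F n * F (Suc n)"
  shows "imat_power (imat_mult L (imat_transpose L)) k 0 0 = fps_nth (F 0) k"
proof -
  define v where "v j = fps_X ^ j * jacobi_vec \<alpha> F (2 * j)" for j
  define w where "w j = fps_X ^ j * jacobi_vec \<alpha> F (2 * j + 1)" for j
  let ?J = "imat_mult L (imat_transpose L)"
  note step = jacobi_vec_step[of \<alpha> F, OF pos F]
  \<comment> \<open>This is \<open>w = L^T v\<close>, while \<open>v_Suc\<close> and
    \<open>v_0\<close> together say \<open>v = e_0 + t L w\<close>.\<close>
  have w_eq: "w j = fps_const (sqrt (\<alpha> (2 * j + 1))) * v j + fps_const (sqrt (\<alpha> (2 * j + 2))) * v (Suc j)" for j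
    using step[of "2 * j"] by (simp add: v_def w_def algebra_simps)
  have v_Suc: "v (Suc j) = fps_X * (fps_const (sqrt (\<alpha> (2 * j + 2))) * w j
        + fps_const (sqrt (\<alpha> (2 * j + 3))) * w (Suc j))" for j
    using step[of "2 * j + 1"] by (simp add: v_def w_def algebra_simps numeral_3_eq_3)
  have v_0: "v 0 = 1 + fps_X * (fps_const (sqrt (\<alpha> 1)) * w 0)"
  proof -
    have r: "fps_const (sqrt (\<alpha> 1)) * fps_const (sqrt (\<alpha> 1)) = fps_const (\<alpha> 1)"
      using pos[of 0] by simp
    have "v 0 = 1 + (fps_const (sqrt (\<alpha> 1)) * fps_const (sqrt (\<alpha> 1))) * fps_X * F 0 * F 1"
      unfolding r using F[of 0] by (simp add: v_def jacobi_vec_0)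
    then show ?thesis
      by (simp add: w_def jacobi_vec_0 jacobi_vec_Suc algebra_simps del: fps_const_mult)
  qed
  \<comment> \<open>Row \<open>i\<close> of \<open>L\<close> lives on columns \<open>i - 1\<close>
    and \<open>i\<close>; for \<open>i = 0\<close> truncated subtraction leaves the diagonal entry
    only.\<close>
  have J: "?J i j = (\<Sum>l\<in>{i - 1..i}. L i l * L j l)" for i j
  proof -
    have "?J i j = (\<Sum>\<^sub>\<infinity>l\<in>{i - 1..i}. L i l * L j l)"
      unfolding imat_mult_def imat_transpose_def
      by (rule infsum_cong_neutral) (auto simp: L)
    then show ?thesis by simp
  qed
  have LT: "(\<Sum>j\<le>m. L j l * fps_nth (v j) k) = fps_nth (w l) k" if "l < m" for l m k
  proof -
    have "(\<Sum>j\<le>m. L j l * fps_nth (v j) k) = (\<Sum>j\<in>{l, Suc l}. L j l * fps_nth (v j) k)"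
      using that by (intro sum.mono_neutral_right) (auto simp: L)
    then show ?thesis by (simp add: w_eq L)
  qed
  have rec: "(\<Sum>j\<le>Suc i. ?J i j * fps_nth (v j) k) = fps_nth (v i) (Suc k)" for i k
  proof -
    have "(\<Sum>j\<le>Suc i. ?J i j * fps_nth (v j) k)
          = (\<Sum>l\<in>{i - 1..i}. L i l * (\<Sum>j\<le>Suc i. L j l * fps_nth (v j) k))"
      unfolding J sum_distrib_right sum_distrib_left by (subst sum.swap) (simp add: mult.assoc)
    also have "\<dots> = (\<Sum>l\<in>{i - 1..i}. L i l * fps_nth (w l) k)"
      by (intro sum.cong refl arg_cong2[where f = "(*)"] LT) auto
    also have "\<dots> = fps_nth (v i) (Suc k)"
    proof (cases i)
      case 0
      then show ?thesis by (simp add: v_0 L)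
    next
      case (Suc j)
      have "{j..Suc j} = {j, Suc j}" by auto
      with Suc show ?thesis by (simp add: v_Suc L numeral_3_eq_3)
    qed
    finally show ?thesis .
  qed
  \<comment> \<open>The induction carries the whole first column, because each power multiplies by
    the matrix on the left.\<close>
  have "imat_power ?J k i 0 = fps_nth (v i) k" for i
  proof (induction k arbitrary: i)
    case 0
    show ?case by (cases i) (simp_all add: v_0 v_Suc)
  next
    case (Suc k)
    have "imat_power ?J (Suc k) i 0 = (\<Sum>\<^sub>\<infinity>j. ?J i j * fps_nth (v j) k)"
      by (simp add: imat_mult_def[of ?J] Suc.IH)
    also have "\<dots> = (\<Sum>\<^sub>\<infinity>j\<in>{..Suc i}. ?J i j * fps_nth (v j) k)"
      by (rule infsum_cong_neutral) (auto simp: J L)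
    finally show ?case using rec[of i k] by simp
  qed
  then show ?thesis by (simp add: v_def jacobi_vec_0)
qed

text \<open>As \<open>F\<close> is the inverse of \<open>U\<close>, the substitution is a
  computation in an integral domain, derivatives entering only through \<open>dF\<close> and
  \<open>dU\<close>. The equation at t = 0, which is \<open>zero\<close>, and the choice of
  \<open>s\<close> make the result divisible by \<open>X * \<alpha>\<close>, which is then
  cancelled.\<close>

lemma riccati_moebius_transform:
  fixes F G U X dF dG dU A B B' C C' \<alpha> s :: "'a::idom"
  assumes FU: "F * U = 1" and U: "U = 1 - \<alpha> * X * G"
    and dF: "dF * U = - F * dU" and dU: "dU = - (\<alpha> * (G + X * dG))"
    and ric: "X * (1 - X) * dF = A + (B + B' * X) * F + (C + C' * X) * F\<^sup>2"
    and zero: "A + B + C = 0" and s: "B' + C' = s * \<alpha>" "s = 1 + A + A + B"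
    and nz: "X * \<alpha> \<noteq> 0"
  shows "X * (1 - X) * dG = s + (- s + (1 - B') * X) * G + A * \<alpha> * X * G\<^sup>2"
proof -
  have "dF * U * U = - (F * U) * dU"
    unfolding dF by (simp only: ac_simps mult_minus_left mult_minus_right)
  then have "\<alpha> * (G + X * dG) = dF * U * U"
    unfolding FU dU by simp
  \<comment> \<open>The factor \<open>U\<^sup>2\<close> clears \<open>F\<close>, because
    \<open>F * U = 1\<close>; what remains is polynomial in \<open>G\<close>.\<close>
  then have "X * \<alpha> * ((1 - X) * (G + X * dG)) = (X * (1 - X) * dF) * U\<^sup>2"
    by (simp only: power2_eq_square ac_simps)
  also have "\<dots> = A * U\<^sup>2 + (B + B' * X) * (F * U) * U + (C + C' * X) * (F * U)\<^sup>2"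
    unfolding ric by (simp add: algebra_simps power2_eq_square)
  also have "\<dots> = (A + B + C) + X * (B' + C') - (A + A + B + B' * X) * (\<alpha> * X * G) + A * (\<alpha> * X * G)\<^sup>2"
    unfolding FU unfolding U by (simp add: algebra_simps power2_eq_square)
  also have "\<dots> = X * \<alpha> * (s - (A + A + B + B' * X) * G + A * \<alpha> * X * G\<^sup>2)"
    unfolding zero s(1) by (simp add: algebra_simps power2_eq_square)
  finally have "(1 - X) * (G + X * dG) = s - (A + A + B + B' * X) * G + A * \<alpha> * X * G\<^sup>2"
    using nz by (simp only: mult_cancel_left simp_thms)
  moreover have "X * (1 - X) * dG = (1 - X) * (G + X * dG) - (1 - X) * G"
    by (simp add: algebra_simps)
  ultimately show ?thesis
    unfolding s(2) by (simp add: algebra_simps)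
qed

text \<open>
  This family of Riccati equations is stable under \<open>F = 1 / (1 - \<alpha> t G)\<close>, provided that
  \<open>\<alpha>\<close> is chosen so as to normalise \<open>G 0 = 1\<close>.
\<close>

lemma riccati_continued_fraction_step:
  fixes F :: "real fps"
  assumes F0: "fps_nth F 0 = 1"
    and ric: "fps_X * (1 - fps_X) * fps_deriv F = fps_const A + (fps_const B + fps_const B' * fps_X) * F
                + (fps_const C + fps_const C' * fps_X) * F\<^sup>2"
    and A: "1 + 2 * A + B \<noteq> 0" and \<alpha>: "\<alpha> \<noteq> 0" "(1 + 2 * A + B) * \<alpha> = B' + C'"
  obtains G where "fps_nth G 0 = 1" "F = 1 + fps_const \<alpha> * fps_X * F * G"
    "fps_X * (1 - fps_X) * fps_deriv G = fps_const (1 + 2 * A + B)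
       + (fps_const (- (1 + 2 * A + B)) + fps_const (1 - B') * fps_X) * G + fps_const (A * \<alpha>) * fps_X * G\<^sup>2"
proof -
  \<comment> \<open>\<open>G\<close> is forced to be \<open>(F - 1) / (\<alpha> t F)\<close>, the
    division by t being a shift because \<open>F\<close> has constant term 1.\<close>
  define G where "G = fps_const (1 / \<alpha>) * fps_shift 1 F * inverse F"
  define U where "U = 1 - fps_const \<alpha> * fps_X * G"
  have inv: "F * inverse F = 1"
    using F0 inverse_mult_eq_1'[of F] by simp
  have "fps_const \<alpha> * fps_X * F * G
      = (fps_const \<alpha> * fps_const (1 / \<alpha>)) * (F * inverse F) * (fps_X * fps_shift 1 F)"
    unfolding G_def by (simp only: ac_simps)
  also have "\<dots> = fps_X * fps_shift 1 F"
    using \<alpha>(1) inv by simp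
  also have "\<dots> = F - 1"
    by (rule fps_ext) (use F0 in auto)
  finally have FG: "F = 1 + fps_const \<alpha> * fps_X * F * G" by simp
  then have FU: "F * U = 1" by (simp add: U_def algebra_simps)
  have dU: "fps_deriv U = - (fps_const \<alpha> * (G + fps_X * fps_deriv G))"
    by (simp add: U_def algebra_simps)
  have "fps_deriv F * U + F * fps_deriv U = 0"
    using arg_cong[OF FU, of fps_deriv] by (simp add: algebra_simps)
  then have dF: "fps_deriv F * U = - F * fps_deriv U"
    by (simp add: eq_neg_iff_add_eq_0)
  have ABC: "A + B + C = 0"
    using arg_cong[OF ric, of "\<lambda>f. fps_nth f 0"] F0 by (simp add: power2_eq_square algebra_simps)
  have "fps_X * (1 - fps_X) * fps_deriv G = fps_const (1 + 2 * A + B)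
       + (- fps_const (1 + 2 * A + B) + (1 - fps_const B') * fps_X) * G
       + fps_const A * fps_const \<alpha> * fps_X * G\<^sup>2"
  proof (rule riccati_moebius_transform[OF FU U_def dF dU ric])
    show "fps_const A + fps_const B + fps_const C = 0"
      by (simp add: ABC)
    show "fps_const B' + fps_const C' = fps_const (1 + 2 * A + B) * fps_const \<alpha>"
      by (simp add: \<alpha>(2))
    show "fps_const (1 + 2 * A + B) = 1 + fps_const A + fps_const A + fps_const B"
      by (simp only: mult_2 fps_const_add[symmetric] fps_const_1_eq_1 add.assoc)
    show "fps_X * fps_const \<alpha> \<noteq> 0"
      using \<alpha>(1) by simp
  qed
  moreover have "fps_const (1 - B') = 1 - fps_const B'"
    by (rule fps_ext) simp
  ultimately have ricG: "fps_X * (1 - fps_X) * fps_deriv G = fps_const (1 + 2 * A + B)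
       + (fps_const (- (1 + 2 * A + B)) + fps_const (1 - B') * fps_X) * G + fps_const (A * \<alpha>) * fps_X * G\<^sup>2"
    by (simp only: fps_const_neg fps_const_mult)
  \<comment> \<open>The new equation at t = 0; its nonzero factor forces the normalisation.\<close>
  have "(1 + 2 * A + B) * (1 - fps_nth G 0) = 0"
    using arg_cong[OF ricG, of "\<lambda>f. fps_nth f 0"] by (simp add: algebra_simps)
  then have "fps_nth G 0 = 1" using A by simp
  from that[OF this FG ricG] show ?thesis .
qed

text \<open>The squared entries of the bidiagonal factor in the order of the continued fraction:
  diagonal ones at odd indices, subdiagonal ones at even indices.\<close>

definition S_coeff :: "real \<Rightarrow> real \<Rightarrow> real \<Rightarrow> nat \<Rightarrow> real" where
  "S_coeff a b c n = (if n = 1 then hat_lambda0 a b c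
     else if even n then mu_coeff a b c (n div 2) else lambda_coeff a b c (n div 2))"

lemma S_coeff_pos:
  assumes "a > -1" "b > -1" "c \<ge> 0"
  shows "S_coeff a b c (Suc n) > 0"
proof (cases "n = 0")
  case True
  then show ?thesis using assms by (simp add: S_coeff_def hat_lambda0_def)
next
  case False
  define j where "j = Suc n div 2"
  have "real j \<ge> 1" using False by (simp add: j_def)
  then have "mu_coeff a b c j > 0" "lambda_coeff a b c j > 0"
    using assms unfolding mu_coeff_def lambda_coeff_def
    by (auto intro!: mult_pos_pos divide_pos_pos)
  moreover have "S_coeff a b c (Suc n) = (if even (Suc n) then mu_coeff a b c j else lambda_coeff a b c j)"
    using False unfolding S_coeff_def j_def by (auto simp del: even_Suc)
  ultimately show ?thesis by simp
qed

lemma jacobi_factor_S_coeff: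
  "jacobi_factor a b c i j = (if i = j then sqrt (S_coeff a b c (2 * i + 1))
     else if i = Suc j then sqrt (S_coeff a b c (2 * i)) else 0)"
  by (auto simp: jacobi_factor_def S_coeff_def)

text \<open>The constant term of the n-th Riccati equation. A step replaces \<open>A\<close> by
  \<open>1 + 2 * A + B\<close>, with \<open>B = - A\<close> for n > 0 and \<open>B = c - A\<close>
  for n = 0; so each step adds 1, except the first, which adds \<open>1 + c\<close>.\<close>

definition riccati_const :: "real \<Rightarrow> real \<Rightarrow> real \<Rightarrow> nat \<Rightarrow> real" where
  "riccati_const a b c n = (if n = 0 then 1 + a + b + c else real n + 1 + a + b + 2 * c)"

text \<open>These are the conditions that normalise each continued fraction step. Cancelling the
  denominators that the constants share with the coefficients leaves one quadratic identity in each
  case.\<close>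

lemma S_coeff_recursion:
  assumes "a > -1" "b > -1" "c \<ge> 0"
  shows "riccati_const a b c 1 * S_coeff a b c 1 = 1 + a + c"
    and "riccati_const a b c (Suc (Suc n)) * S_coeff a b c (Suc (Suc n))
      = (if even n then - a else 1 + a) + riccati_const a b c n * S_coeff a b c (Suc n)"
proof -
  show "riccati_const a b c 1 * S_coeff a b c 1 = 1 + a + c"
    using assms by (simp add: riccati_const_def S_coeff_def hat_lambda0_def field_simps)
  have cancel: "x * (u / x * (v / z)) = u * v / z" "x * (u / z * (v / x)) = u * v / z"
    if "x > 0" for x u v z :: real
    using that by (simp_all add: field_simps)
  have split: "(s * z + u) / z = s + u / z" if "z > 0" for s u z :: real
    using that by (simp add: field_simps)
  consider "n = 0" | j where "n = 2 * j" "j \<ge> 1" | j where "n = 2 * j + 1"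
    by (cases "n = 0"; cases "even n") (auto elim!: evenE oddE)
  then show "riccati_const a b c (Suc (Suc n)) * S_coeff a b c (Suc (Suc n))
      = (if even n then - a else 1 + a) + riccati_const a b c n * S_coeff a b c (Suc n)"
  proof cases
    case 1
    define p q where "p = 2 * c + a + b + 2" and "q = 2 * c + a + b + 3"
    have pq: "p > 0" "q > 0" using assms by (auto simp: p_def q_def)
    have "riccati_const a b c 2 * S_coeff a b c 2 = q * ((1 + c) / q * ((1 + c + b) / p))"
      unfolding p_def q_def by (simp add: riccati_const_def S_coeff_def mu_coeff_def algebra_simps)
    moreover have "riccati_const a b c 0 * S_coeff a b c 1 = (1 + a + b + c) * (1 + a + c) / p"
      unfolding p_def by (simp add: riccati_const_def S_coeff_def hat_lambda0_def algebra_simps)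
    moreover have "(1 + c) * (1 + c + b) = - a * p + (1 + a + b + c) * (1 + a + c)"
      unfolding p_def by algebra
    ultimately have "riccati_const a b c 2 * S_coeff a b c 2 = - a + riccati_const a b c 0 * S_coeff a b c 1"
      using pq by (simp only: cancel split)
    then show ?thesis
      using 1 by (simp add: numeral_2_eq_2)
  next
    case (2 j)
    define y where "y = real j + c"
    define p q r where "p = 2 * y + a + b + 1" and "q = 2 * y + a + b + 2" and "r = 2 * y + a + b + 3"
    have y: "y \<ge> 1" using 2 assms by (simp add: y_def)
    have pq: "p > 0" "q > 0" "r > 0" using assms y by (auto simp: p_def q_def r_def)
    have "riccati_const a b c (Suc (Suc n)) * S_coeff a b c (Suc (Suc n))
        = r * ((y + 1) / r * ((y + 1 + b) / q))"
      using 2 unfolding riccati_const_def S_coeff_def mu_coeff_def y_def q_def r_def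
      by (simp add: algebra_simps)
    moreover have "riccati_const a b c n * S_coeff a b c (Suc n) = p * ((y + a + 1) / q * ((y + a + b + 1) / p))"
      using 2 unfolding riccati_const_def S_coeff_def lambda_coeff_def y_def q_def p_def
      by (simp add: algebra_simps)
    moreover have "(y + 1) * (y + 1 + b) = - a * q + (y + a + 1) * (y + a + b + 1)"
      unfolding q_def by algebra
    ultimately have "riccati_const a b c (Suc (Suc n)) * S_coeff a b c (Suc (Suc n))
        = - a + riccati_const a b c n * S_coeff a b c (Suc n)"
      using pq by (simp only: cancel split)
    then show ?thesis using 2 by simp
  next
    case (3 j)
    define y where "y = real j + 1 + c"
    define p q r where "p = 2 * y + a + b" and "q = 2 * y + a + b + 1" and "r = 2 * y + a + b + 2"
    have y: "y \<ge> 1" using assms by (simp add: y_def)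
    have pq: "p > 0" "q > 0" "r > 0" using assms y by (auto simp: p_def q_def r_def)
    have "riccati_const a b c (Suc (Suc n)) * S_coeff a b c (Suc (Suc n))
        = r * ((y + a + 1) / r * ((y + a + b + 1) / q))"
      using 3 unfolding riccati_const_def S_coeff_def lambda_coeff_def y_def q_def r_def
      by (simp add: algebra_simps)
    moreover have "riccati_const a b c n * S_coeff a b c (Suc n) = p * (y / q * ((y + b) / p))"
      using 3 unfolding riccati_const_def S_coeff_def mu_coeff_def y_def q_def p_def
      by (simp add: algebra_simps)
    moreover have "(y + a + 1) * (y + a + b + 1) = (1 + a) * q + y * (y + b)"
      unfolding q_def by algebra
    ultimately have "riccati_const a b c (Suc (Suc n)) * S_coeff a b c (Suc (Suc n))
        = 1 + a + riccati_const a b c n * S_coeff a b c (Suc n)"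
      using pq by (simp only: cancel split)
    then show ?thesis using 3 by simp
  qed
qed

text \<open>Dependent choice iterates the step. Here \<open>B'\<close> alternates between
  \<open>1 + a\<close> and \<open>- a\<close>, since a step sends it to \<open>1 - B'\<close>;
  \<open>C\<close> is 0 after the first step, and \<open>C'\<close> is the product of the preceding
  constant and coefficient.\<close>

lemma riccati_S_fraction:
  fixes F :: "real fps"
  assumes abc: "a > -1" "b > -1" "c \<ge> 0"
    and F0: "fps_nth F 0 = 1"
    and ric: "fps_X * (1 - fps_X) * fps_deriv F = fps_const (1 + a + b + c)
                + (fps_const (- (1 + a + b)) + fps_const (1 + a) * fps_X) * F
                + (fps_const (- c) + fps_const c * fps_X) * F\<^sup>2"
  obtains G where "G 0 = F"
    "\<And>n. G n = 1 + fps_const (S_coeff a b c (Suc n)) * fps_X * G n * G (Suc n)"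
proof -
  let ?A = "riccati_const a b c" and ?\<alpha> = "S_coeff a b c"
  \<comment> \<open>The clause for \<open>n = 0\<close> makes the chosen sequence start at
    \<open>F\<close>.\<close>
  define P where "P n f \<longleftrightarrow> fps_nth f 0 = 1 \<and> (n = 0 \<longrightarrow> f = F) \<and>
     fps_X * (1 - fps_X) * fps_deriv f = fps_const (?A n)
       + (fps_const (- (?A n + (if n = 0 then - c else 0))) + fps_const (if even n then 1 + a else - a) * fps_X) * f
       + (fps_const (if n = 0 then - c else 0)
          + fps_const (if n = 0 then c else ?A (n - 1) * ?\<alpha> n) * fps_X) * f\<^sup>2" for n f
  have "P 0 F"
    using F0 ric by (simp add: P_def riccati_const_def)
  moreover have "\<exists>g. P (Suc n) g \<and> f = 1 + fps_const (?\<alpha> (Suc n)) * fps_X * f * g" if "P n f" for n f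
  proof -
    have f: "fps_nth f 0 = 1"
      and f_ric: "fps_X * (1 - fps_X) * fps_deriv f = fps_const (?A n)
       + (fps_const (- (?A n + (if n = 0 then - c else 0))) + fps_const (if even n then 1 + a else - a) * fps_X) * f
       + (fps_const (if n = 0 then - c else 0)
          + fps_const (if n = 0 then c else ?A (n - 1) * ?\<alpha> n) * fps_X) * f\<^sup>2"
      using that unfolding P_def by blast+
    have A_Suc: "1 + 2 * ?A n + - (?A n + (if n = 0 then - c else 0)) = ?A (Suc n)"
      by (simp add: riccati_const_def)
    have "?A (Suc n) \<noteq> 0" "?\<alpha> (Suc n) \<noteq> 0"
      using abc S_coeff_pos[OF abc, of n] by (simp_all add: riccati_const_def)
    moreover have "?A (Suc n) * ?\<alpha> (Suc n)
        = (if even n then 1 + a else - a) + (if n = 0 then c else ?A (n - 1) * ?\<alpha> n)"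
      using S_coeff_recursion[OF abc] by (cases n) auto
    ultimately obtain g where g: "fps_nth g 0 = 1" "f = 1 + fps_const (?\<alpha> (Suc n)) * fps_X * f * g"
      "fps_X * (1 - fps_X) * fps_deriv g = fps_const (?A (Suc n))
       + (fps_const (- ?A (Suc n)) + fps_const (1 - (if even n then 1 + a else - a)) * fps_X) * g
       + fps_const (?A n * ?\<alpha> (Suc n)) * fps_X * g\<^sup>2"
      by (rule riccati_continued_fraction_step[OF f f_ric, unfolded A_Suc])
    have "1 - (if even n then 1 + a else - a) = (if even (Suc n) then 1 + a else - a)"
      by simp
    with g(1,3) have "P (Suc n) g"
      unfolding P_def by (simp only: nat.simps if_False if_True diff_Suc_1 add_0_right fps_const_0_eq_0 add_0_left simp_thms)
    with g(2) show ?thesis by blast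
  qed
  ultimately obtain G where "\<And>n. P n (G n) \<and> G n = 1 + fps_const (?\<alpha> (Suc n)) * fps_X * G n * G (Suc n)"
    using dependent_nat_choice[of P "\<lambda>n f g. f = 1 + fps_const (?\<alpha> (Suc n)) * fps_X * f * g"] by blast
  then show ?thesis
    by (intro that[of G]) (auto simp: P_def)
qed

text \<open>\<open>rec\<close> is the limiting loop equation, and also the coefficient of degree
  \<open>k + 1\<close> in the Riccati equation for the generating function; degree 0 holds by
  \<open>m 0 = 1\<close>.\<close>

proposition J_mat_power_00:
  assumes abc: "a > -1" "b > -1" "c \<ge> 0"
    and m0: "m 0 = 1"
    and rec: "\<And>k. (real k + 1 + a) * m k - (real k + 2 + a + b) * m (Suc k)
        + c * ((\<Sum>p\<le>k. m p * m (k - p)) - (\<Sum>p\<le>Suc k. m p * m (Suc k - p))) = 0"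
  shows "imat_power (J_mat a b c) k 0 0 = m k"
proof -
  define F where "F = Abs_fps m"
  have sq: "fps_nth (F\<^sup>2) k = (\<Sum>p\<le>k. m p * m (k - p))" for k
    by (simp add: F_def power2_eq_square fps_mult_nth atMost_atLeast0)
  have "fps_X * (1 - fps_X) * fps_deriv F = fps_const (1 + a + b + c)
                + (fps_const (- (1 + a + b)) + fps_const (1 + a) * fps_X) * F
                + (fps_const (- c) + fps_const c * fps_X) * F\<^sup>2" (is "?l = ?r")
  proof (rule fps_ext)
    fix n
    show "fps_nth ?l n = fps_nth ?r n"
    proof (cases n)
      case 0
      then show ?thesis using m0 by (simp add: sq distrib_right mult.assoc) (simp add: F_def)
    next
      case (Suc k)
      have l: "?l = fps_X * (fps_deriv F - fps_X * fps_deriv F)"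
        by (simp add: algebra_simps)
      have lhs: "fps_nth ?l (Suc k) = (real k + 1) * m (Suc k) - real k * m k"
        unfolding l by (cases k) (simp_all add: F_def algebra_simps)
      have rhs: "fps_nth ?r (Suc k) = - (1 + a + b) * m (Suc k) + (1 + a) * m k
           - c * (\<Sum>p\<le>Suc k. m p * m (Suc k - p)) + c * (\<Sum>p\<le>k. m p * m (k - p))"
        by (simp only: distrib_right mult.assoc fps_add_nth fps_mult_left_const_nth fps_X_mult_nth sq)
           (simp add: sq, simp add: F_def)
      show ?thesis
        unfolding Suc lhs rhs using rec[of k] by (simp add: algebra_simps)
    qed
  qed
  then obtain G where G: "G 0 = F"
    "\<And>n. G n = 1 + fps_const (S_coeff a b c (Suc n)) * fps_X * G n * G (Suc n)"
    using riccati_S_fraction[OF abc, of F] m0 by (auto simp: F_def)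
  have "imat_power (J_mat a b c) k 0 0 = fps_nth (G 0) k"
    unfolding J_mat_def
    using tridiagonal_power_00[OF jacobi_factor_S_coeff S_coeff_pos[OF abc] G(2)] .
  then show ?thesis by (simp add: G(1) F_def)
qed

section \<open>A change of variables for the ensemble\<close>

text \<open>Substitution for indicators identifies a pushed forward measure with restricted Lebesgue
  measure; this equality of measures then covers all functions with values in
  \<open>ennreal\<close>.\<close>

lemma nn_integral_substitution_ennreal:
  fixes g g' :: "real \<Rightarrow> real" and f :: "real \<Rightarrow> ennreal"
  assumes [measurable]: "f \<in> borel_measurable borel" "g \<in> borel_measurable borel" "g' \<in> borel_measurable borel"
    and deriv: "\<And>x. x \<in> {a..b} \<Longrightarrow> (g has_real_derivative g' x) (at x)"
    and cont: "continuous_on {a..b} g'"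
    and nonneg: "\<And>x. x \<in> {a..b} \<Longrightarrow> g' x \<ge> 0" and "a \<le> b"
  shows "(\<integral>\<^sup>+x. f (g x) * (ennreal (g' x) * indicator {a..b} x) \<partial>lborel)
       = (\<integral>\<^sup>+x. f x * indicator {g a..g b} x \<partial>lborel)"
proof -
  have eq: "distr (density lborel (\<lambda>x. ennreal (g' x) * indicator {a..b} x)) borel g
      = density lborel (indicator {g a..g b})"
  proof (rule measure_eqI)
    fix A assume "A \<in> sets (distr (density lborel (\<lambda>x. ennreal (g' x) * indicator {a..b} x)) borel g)"
    then have A [measurable]: "A \<in> sets borel" by simp
    have [measurable]: "g -` A \<in> sets borel"
      using measurable_sets_borel[OF assms(2) A] .
    have "emeasure (distr (density lborel (\<lambda>x. ennreal (g' x) * indicator {a..b} x)) borel g) A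
        = (\<integral>\<^sup>+x. ennreal (g' x) * indicator {a..b} x * indicator (g -` A) x \<partial>lborel)"
      by (simp add: emeasure_distr emeasure_density)
    also have "\<dots> = (\<integral>\<^sup>+x. ennreal (indicator A (g x) * g' x * indicator {a..b} x) \<partial>lborel)"
      by (intro nn_integral_cong) (auto split: split_indicator)
    also have "\<dots> = (\<integral>\<^sup>+x. ennreal (indicator A x * indicator {g a..g b} x) \<partial>lborel)"
      by (intro nn_integral_substitution[symmetric] deriv cont nonneg \<open>a \<le> b\<close>)
         (simp add: set_borel_measurable_def)
    also have "\<dots> = (\<integral>\<^sup>+x. indicator {g a..g b} x * indicator A x \<partial>lborel)"
      by (intro nn_integral_cong) (auto split: split_indicator)
    also have "\<dots> = emeasure (density lborel (indicator {g a..g b})) A"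
      by (simp add: emeasure_density)
    finally show "emeasure (distr (density lborel (\<lambda>x. ennreal (g' x) * indicator {a..b} x)) borel g) A
        = emeasure (density lborel (indicator {g a..g b})) A" .
  qed simp
  have "(\<integral>\<^sup>+x. f x \<partial>distr (density lborel (\<lambda>x. ennreal (g' x) * indicator {a..b} x)) borel g)
      = (\<integral>\<^sup>+x. ennreal (g' x) * indicator {a..b} x * f (g x) \<partial>lborel)"
    by (simp add: nn_integral_distr nn_integral_density)
  moreover have "(\<integral>\<^sup>+x. f x \<partial>density lborel (indicator {g a..g b}))
      = (\<integral>\<^sup>+x. indicator {g a..g b} x * f x \<partial>lborel)"
    by (simp add: nn_integral_density)
  ultimately show ?thesis
    unfolding eq by (simp only: mult.commute)
qed

text \<open>Fubini, one coordinate at a time: \<open>one\<close> transforms the new coordinate, and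
  the induction hypothesis is applied to the partial integral \<open>H\<close> over it.\<close>

lemma nn_integral_PiM_componentwise:
  fixes \<phi> :: "real \<Rightarrow> real" and w v :: "real \<Rightarrow> ennreal"
  assumes [measurable]: "\<phi> \<in> borel_measurable borel" "w \<in> borel_measurable borel" "v \<in> borel_measurable borel"
    and one: "\<And>f. f \<in> borel_measurable borel \<Longrightarrow> (\<integral>\<^sup>+x. f (\<phi> x) * w x \<partial>lborel) = (\<integral>\<^sup>+x. f x * v x \<partial>lborel)"
    and "finite I" "F \<in> borel_measurable (Pi\<^sub>M I (\<lambda>_. lborel))"
  shows "(\<integral>\<^sup>+x. F (\<lambda>i\<in>I. \<phi> (x i)) * (\<Prod>i\<in>I. w (x i)) \<partial>Pi\<^sub>M I (\<lambda>_. lborel))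
       = (\<integral>\<^sup>+x. F x * (\<Prod>i\<in>I. v (x i)) \<partial>Pi\<^sub>M I (\<lambda>_. lborel))"
  using assms(5,6)
proof (induction I arbitrary: F rule: finite_induct)
  case empty
  then show ?case by (simp add: nn_integral_count_space_finite PiM_empty restrict_def)
next
  case (insert i I)
  interpret product_sigma_finite "\<lambda>_. lborel :: real measure" ..
  note [measurable] = insert.prems
  have F_upd [measurable]: "(\<lambda>y. F (x(i := y))) \<in> borel_measurable borel"
    if "x \<in> space (Pi\<^sub>M I (\<lambda>_. lborel))" for x
    using measurable_compose[OF measurable_component_update[OF that insert.hyps(2)] insert.prems]
    by (simp add: fun_upd_def)
  define H where "H z = (\<integral>\<^sup>+y. F (z(i := y)) * v y \<partial>lborel)" for z
  have H [measurable]: "H \<in> borel_measurable (Pi\<^sub>M I (\<lambda>_. lborel))"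
    unfolding H_def by measurable
  have "(\<integral>\<^sup>+x. F (\<lambda>j\<in>insert i I. \<phi> (x j)) * (\<Prod>j\<in>insert i I. w (x j)) \<partial>Pi\<^sub>M (insert i I) (\<lambda>_. lborel))
      = (\<integral>\<^sup>+x. (\<integral>\<^sup>+y. F (\<lambda>j\<in>insert i I. \<phi> ((x(i := y)) j)) * (\<Prod>j\<in>insert i I. w ((x(i := y)) j)) \<partial>lborel)
           \<partial>Pi\<^sub>M I (\<lambda>_. lborel))"
    by (subst product_nn_integral_insert) (use insert.hyps in \<open>auto intro!: measurable_restrict\<close>)
  also have "\<dots> = (\<integral>\<^sup>+x. H (\<lambda>j\<in>I. \<phi> (x j)) * (\<Prod>j\<in>I. w (x j)) \<partial>Pi\<^sub>M I (\<lambda>_. lborel))"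
  proof (rule nn_integral_cong)
    fix x assume x: "x \<in> space (Pi\<^sub>M I (\<lambda>_. lborel :: real measure))"
    let ?z = "\<lambda>j\<in>I. \<phi> (x j)"
    have z: "?z \<in> space (Pi\<^sub>M I (\<lambda>_. lborel))" by (simp add: space_PiM)
    have upd: "(\<lambda>j\<in>insert i I. \<phi> ((x(i := y)) j)) = ?z(i := \<phi> y)" for y
      using insert.hyps by (auto simp: fun_eq_iff)
    have prod: "(\<Prod>j\<in>insert i I. w ((x(i := y)) j)) = w y * (\<Prod>j\<in>I. w (x j))" for y
      using insert.hyps by (auto intro!: prod.cong arg_cong2[where f = "(*)"])
    have "(\<integral>\<^sup>+y. F (?z(i := \<phi> y)) * (w y * (\<Prod>j\<in>I. w (x j))) \<partial>lborel)
        = (\<integral>\<^sup>+y. F (?z(i := \<phi> y)) * w y \<partial>lborel) * (\<Prod>j\<in>I. w (x j))"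
      using measurable_compose[OF assms(1) F_upd[OF z]]
      by (subst nn_integral_multc[symmetric]) (auto simp: mult.assoc)
    also have "(\<integral>\<^sup>+y. F (?z(i := \<phi> y)) * w y \<partial>lborel) = H ?z"
      unfolding H_def by (rule one) (rule F_upd[OF z])
    finally show "(\<integral>\<^sup>+y. F (\<lambda>j\<in>insert i I. \<phi> ((x(i := y)) j)) * (\<Prod>j\<in>insert i I. w ((x(i := y)) j)) \<partial>lborel)
        = H ?z * (\<Prod>j\<in>I. w (x j))"
      unfolding upd prod .
  qed
  also have "\<dots> = (\<integral>\<^sup>+x. H x * (\<Prod>j\<in>I. v (x j)) \<partial>Pi\<^sub>M I (\<lambda>_. lborel))"
    by (rule insert.IH[OF H])
  also have "\<dots> = (\<integral>\<^sup>+x. (\<integral>\<^sup>+y. F (x(i := y)) * (\<Prod>j\<in>insert i I. v ((x(i := y)) j)) \<partial>lborel) \<partial>Pi\<^sub>M I (\<lambda>_. lborel))"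
  proof (rule nn_integral_cong)
    fix x assume x: "x \<in> space (Pi\<^sub>M I (\<lambda>_. lborel :: real measure))"
    have prod: "(\<Prod>j\<in>insert i I. v ((x(i := y)) j)) = v y * (\<Prod>j\<in>I. v (x j))" for y
      using insert.hyps by (auto intro!: prod.cong arg_cong2[where f = "(*)"])
    show "H x * (\<Prod>j\<in>I. v (x j)) = (\<integral>\<^sup>+y. F (x(i := y)) * (\<Prod>j\<in>insert i I. v ((x(i := y)) j)) \<partial>lborel)"
      unfolding H_def prod using F_upd[OF x]
      by (subst nn_integral_multc[symmetric]) (auto simp: mult.assoc)
  qed
  also have "\<dots> = (\<integral>\<^sup>+x. F x * (\<Prod>j\<in>insert i I. v (x j)) \<partial>Pi\<^sub>M (insert i I) (\<lambda>_. lborel))"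
    by (subst product_nn_integral_insert) (use insert.hyps in auto)
  finally show ?case .
qed

section \<open>The perturbation of the unit interval and its divided differences\<close>

definition kern :: "nat \<Rightarrow> real \<Rightarrow> real \<Rightarrow> real" where
  "kern k x y = (\<Sum>p\<le>k. x ^ p * y ^ (k - p)) - (\<Sum>p\<le>Suc k. x ^ p * y ^ (Suc k - p))"

definition flow :: "nat \<Rightarrow> real \<Rightarrow> real \<Rightarrow> real" where
  "flow k s x = x + s * (x ^ Suc k * (1 - x))"

text \<open>\<open>kern\<close> is the divided difference of \<open>x ^ Suc k * (1 - x)\<close>, so
  it governs how the perturbation changes each factor of the Vandermonde product.\<close>

lemma flow_diff: "flow k s x - flow k s y = (x - y) * (1 + s * kern k x y)"
proof -
  have "(x - y) * (\<Sum>p\<le>n. x ^ p * y ^ (n - p)) = x ^ Suc n - y ^ Suc n" for n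
    unfolding power_diff_sumr2[of x "Suc n" y] lessThan_Suc_atMost
    by (simp add: mult.commute)
  from this[of k] this[of "Suc k"]
  have "(x - y) * kern k x y = (x ^ Suc k - y ^ Suc k) - (x ^ Suc (Suc k) - y ^ Suc (Suc k))"
    by (simp only: kern_def right_diff_distrib)
  moreover have "flow k s x - flow k s y
      = (x - y) + s * ((x ^ Suc k - y ^ Suc k) - (x ^ Suc (Suc k) - y ^ Suc (Suc k)))"
    by (simp add: flow_def algebra_simps)
  ultimately have "flow k s x - flow k s y = (x - y) + s * ((x - y) * kern k x y)"
    by (simp only:)
  then show ?thesis by (simp add: algebra_simps)
qed

lemma flow_0 [simp]: "flow k s 0 = 0" and flow_1 [simp]: "flow k s 1 = 1"
  by (simp_all add: flow_def)

lemma kern_diag: "kern k x x = (real k + 1) * x ^ k - (real k + 2) * x ^ Suc k"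
proof -
  have "(\<Sum>p\<le>n. x ^ p * x ^ (n - p)) = (real n + 1) * x ^ n" for n
    by (simp add: power_add[symmetric])
  from this[of k] this[of "Suc k"] show ?thesis
    by (simp only: kern_def) simp
qed

lemma flow_deriv: "(flow k s has_real_derivative 1 + s * kern k x x) (at x)"
proof -
  have "flow k s = (\<lambda>x. x + s * (x ^ Suc k - x ^ Suc (Suc k)))"
    by (simp add: flow_def fun_eq_iff algebra_simps)
  moreover have "((\<lambda>x. x + s * (x ^ Suc k - x ^ Suc (Suc k))) has_real_derivative
      1 + s * (real (Suc k) * x ^ k - real (Suc (Suc k)) * x ^ Suc k)) (at x)"
    using DERIV_pow[of "Suc k" x UNIV] DERIV_pow[of "Suc (Suc k)" x UNIV]
    by (intro DERIV_add DERIV_ident DERIV_cmult DERIV_diff) (simp_all only: diff_Suc_1 One_nat_def[symmetric])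
  ultimately show ?thesis
    by (simp add: kern_diag add.commute)
qed

text \<open>Both sums in \<open>kern\<close> are nonnegative, so their difference is bounded by the
  larger of their bounds.\<close>

lemma abs_kern_le:
  assumes "x \<in> {0..1}" "y \<in> {0..1}"
  shows "\<bar>kern k x y\<bar> \<le> real k + 2"
proof -
  have "(\<Sum>p\<le>n. x ^ p * y ^ (n - p)) \<in> {0..real n + 1}" for n
  proof -
    have "x ^ p * y ^ (n - p) \<le> 1" for p
      using assms by (intro mult_le_one power_le_one) auto
    then have "(\<Sum>p\<le>n. x ^ p * y ^ (n - p)) \<le> (\<Sum>p\<le>n. 1)"
      by (intro sum_mono)
    moreover have "(\<Sum>p\<le>n. x ^ p * y ^ (n - p)) \<ge> 0"
      using assms by (intro sum_nonneg) auto
    ultimately show ?thesis by simp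
  qed
  from this[of k] this[of "Suc k"] show ?thesis
    unfolding kern_def atLeastAtMost_iff by linarith
qed

lemma kern_commute: "kern k x y = kern k y x"
proof -
  have "(\<Sum>p\<le>n. x ^ p * y ^ (n - p)) = (\<Sum>p\<le>n. y ^ p * x ^ (n - p))" for n
    by (rule sum.reindex_bij_witness[of _ "\<lambda>p. n - p" "\<lambda>p. n - p"]) auto
  then show ?thesis by (simp only: kern_def)
qed

lemma kern_measurable [measurable (raw)]:
  assumes [measurable]: "f \<in> borel_measurable M" "g \<in> borel_measurable M"
  shows "(\<lambda>x. kern k (f x) (g x)) \<in> borel_measurable M"
  unfolding kern_def by measurable

lemma flow_measurable [measurable (raw)]:
  assumes [measurable]: "f \<in> borel_measurable M"
  shows "(\<lambda>x. flow k s (f x)) \<in> borel_measurable M"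
  unfolding flow_def by measurable

text \<open>The bound on \<open>s\<close> keeps the derivative nonnegative on [0, 1], and both end
  points are fixed.\<close>

lemma nn_integral_flow:
  assumes s: "\<bar>s\<bar> * (real k + 2) \<le> 1 / 2" and f: "f \<in> borel_measurable borel"
  shows "(\<integral>\<^sup>+x. f (flow k s x) * (ennreal (1 + s * kern k x x) * indicator {0..1} x) \<partial>lborel)
       = (\<integral>\<^sup>+x. f x * indicator {0..1} x \<partial>lborel)"
proof -
  have "1 + s * kern k x x \<ge> 0" if "x \<in> {0..1}" for x
  proof -
    have "\<bar>s * kern k x x\<bar> \<le> \<bar>s\<bar> * (real k + 2)"
      unfolding abs_mult by (intro mult_left_mono abs_kern_le that) simp
    with s show ?thesis by linarith
  qed
  moreover have "continuous_on {0..1} (\<lambda>x. 1 + s * kern k x x)"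
    unfolding kern_diag by (intro continuous_intros)
  ultimately show ?thesis
    using nn_integral_substitution_ennreal[OF f, of "flow k s" "\<lambda>x. 1 + s * kern k x x" 0 1] flow_deriv
    by simp
qed

text \<open>The second order bound for the logarithm near 1. The exponent may be negative, as
  \<open>a\<close> and \<open>b\<close> may be, hence \<open>\<bar>t\<bar>\<close> in the
  error.\<close>

lemma powr_one_plus_ge:
  fixes t u d :: real
  assumes "\<bar>u\<bar> \<le> d" "d \<le> 1 / 2"
  shows "(1 + u) powr t \<ge> exp (t * u - \<bar>t\<bar> * (2 * d\<^sup>2))"
proof -
  have "\<bar>ln (1 + u) - u\<bar> \<le> 2 * u\<^sup>2"
    using assms by (intro abs_ln_one_plus_x_minus_x_bound) auto
  also have "\<dots> \<le> 2 * d\<^sup>2"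
    using power_mono[OF assms(1), of 2] by simp
  finally have "\<bar>t * (ln (1 + u) - u)\<bar> \<le> \<bar>t\<bar> * (2 * d\<^sup>2)"
    unfolding abs_mult by (rule mult_left_mono) simp
  then have "t * u - \<bar>t\<bar> * (2 * d\<^sup>2) \<le> t * ln (1 + u)"
    by (simp add: algebra_simps)
  with assms show ?thesis by (simp add: powr_def)
qed

text \<open>
  The derivative at \<open>s = 0\<close> of the logarithm of the density factor produced by \<open>flow k s\<close>.
\<close>

definition loop_sum :: "real \<Rightarrow> real \<Rightarrow> real \<Rightarrow> nat \<Rightarrow> nat \<Rightarrow> (nat \<Rightarrow> real) \<Rightarrow> real" where
  "loop_sum a b \<beta> k N x = (\<Sum>j\<in>{1..N}. \<Sum>i\<in>{1..<j}. \<beta> * kern k (x j) (x i))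
     + (\<Sum>l\<in>{1..N}. a * (x l ^ k * (1 - x l)) - b * x l ^ Suc k + kern k (x l) (x l))"

text \<open>Every difference, every \<open>x l\<close> and \<open>1 - x l\<close>, and the
  derivative contribute a factor \<open>1 + u\<close> with
  \<open>\<bar>u\<bar> \<le> \<bar>s\<bar> * (real k + 2)\<close>. To first order these factors give
  \<open>loop_sum\<close>; the error counts at most N^2 pairs with exponent \<open>\<beta>\<close>
  and N points with total exponent \<open>\<bar>a\<bar> + \<bar>b\<bar> + 1\<close>.\<close>

lemma beta_jacobi_weight_flow:
  fixes x :: "nat \<Rightarrow> real"
  assumes x: "\<And>i. i \<in> {1..N} \<Longrightarrow> 0 < x i \<and> x i < 1" and s: "\<bar>s\<bar> * (real k + 2) \<le> 1 / 2" and "\<beta> \<ge> 0"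
  shows "beta_jacobi_weight a b \<beta> N x
       * exp (s * loop_sum a b \<beta> k N x - 2 * (\<bar>s\<bar> * (real k + 2))\<^sup>2 * (real N * (\<beta> * real N + \<bar>a\<bar> + \<bar>b\<bar> + 1)))
     \<le> beta_jacobi_weight a b \<beta> N (\<lambda>i\<in>{1..N}. flow k s (x i)) * (\<Prod>l\<in>{1..N}. 1 + s * kern k (x l) (x l))"
proof -
  define d where "d = \<bar>s\<bar> * (real k + 2)"
  define E where "E = 2 * d\<^sup>2"
  have d: "d \<le> 1 / 2" "d \<ge> 0" and E: "E \<ge> 0" using s by (auto simp: d_def E_def)
  have bound: "\<bar>s * u\<bar> \<le> d" if "\<bar>u\<bar> \<le> real k + 2" for u
    unfolding d_def abs_mult using that by (intro mult_left_mono) auto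
  have bk: "\<bar>s * kern k (x i) (x j)\<bar> \<le> d" if "i \<in> {1..N}" "j \<in> {1..N}" for i j
    using x[OF that(1)] x[OF that(2)] by (intro bound abs_kern_le) auto
  have b1: "\<bar>s * (x l ^ k * (1 - x l))\<bar> \<le> d" and b2: "\<bar>s * - (x l ^ Suc k)\<bar> \<le> d" if "l \<in> {1..N}" for l
  proof -
    have "x l ^ k * (1 - x l) \<le> 1" "x l ^ Suc k \<le> 1"
      using x[OF that] by (auto intro!: mult_le_one power_le_one simp del: power_Suc)
    moreover have "x l ^ k * (1 - x l) \<ge> 0" "x l ^ Suc k \<ge> 0"
      using x[OF that] by auto
    ultimately show "\<bar>s * (x l ^ k * (1 - x l))\<bar> \<le> d" "\<bar>s * - (x l ^ Suc k)\<bar> \<le> d"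
      by (auto intro!: bound simp del: power_Suc)
  qed
  \<comment> \<open>The perturbation vanishes at both end points, so even the possibly singular end
    point weights change by bounded factors.\<close>
  have flow1: "flow k s (x l) = x l * (1 + s * (x l ^ k * (1 - x l)))"
    and flow2: "1 - flow k s (x l) = (1 - x l) * (1 + s * - (x l ^ Suc k))" for l
    by (simp_all add: flow_def algebra_simps)
  have pos: "1 + u > 0" if "\<bar>u\<bar> \<le> d" for u using that d by linarith
  have flow01: "0 < flow k s (x l) \<and> flow k s (x l) < 1" if "l \<in> {1..N}" for l
  proof -
    have "flow k s (x l) > 0"
      unfolding flow1 using x[OF that] pos[OF b1[OF that]] by simp
    moreover have "1 - flow k s (x l) > 0"
      unfolding flow2 using x[OF that] pos[OF b2[OF that]] by (intro mult_pos_pos) auto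
    ultimately show ?thesis by simp
  qed
  have pair: "\<bar>x j - x i\<bar> powr \<beta> * exp (s * (\<beta> * kern k (x j) (x i)) - \<beta> * E)
      \<le> \<bar>flow k s (x j) - flow k s (x i)\<bar> powr \<beta>" if "i \<in> {1..N}" "j \<in> {1..N}" for i j
  proof -
    have "\<bar>flow k s (x j) - flow k s (x i)\<bar> powr \<beta> = \<bar>x j - x i\<bar> powr \<beta> * (1 + s * kern k (x j) (x i)) powr \<beta>"
      using pos[OF bk[OF that(2,1)]] by (simp add: flow_diff abs_mult powr_mult)
    moreover have "(1 + s * kern k (x j) (x i)) powr \<beta> \<ge> exp (\<beta> * (s * kern k (x j) (x i)) - \<bar>\<beta>\<bar> * (2 * d\<^sup>2))"
      by (intro powr_one_plus_ge bk that d)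
    ultimately show ?thesis
      using \<open>\<beta> \<ge> 0\<close> by (auto intro!: mult_left_mono simp: E_def ac_simps)
  qed
  have single: "x l powr a * (1 - x l) powr b
        * exp (s * (a * (x l ^ k * (1 - x l)) - b * x l ^ Suc k + kern k (x l) (x l)) - (\<bar>a\<bar> + \<bar>b\<bar> + 1) * E)
      \<le> flow k s (x l) powr a * (1 - flow k s (x l)) powr b * (1 + s * kern k (x l) (x l))"
    if l: "l \<in> {1..N}" for l
  proof -
    \<comment> \<open>The derivative is treated as a factor of exponent 1, the source of the 1 in
      \<open>\<bar>a\<bar> + \<bar>b\<bar> + 1\<close>.\<close>
    have "exp (s * (a * (x l ^ k * (1 - x l)) - b * x l ^ Suc k + kern k (x l) (x l)) - (\<bar>a\<bar> + \<bar>b\<bar> + 1) * E)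
        = exp (a * (s * (x l ^ k * (1 - x l))) - \<bar>a\<bar> * (2 * d\<^sup>2))
          * exp (b * (s * - (x l ^ Suc k)) - \<bar>b\<bar> * (2 * d\<^sup>2))
          * exp (1 * (s * kern k (x l) (x l)) - \<bar>1\<bar> * (2 * d\<^sup>2))"
      unfolding exp_add[symmetric] E_def by (simp add: algebra_simps)
    also have "\<dots> \<le> (1 + s * (x l ^ k * (1 - x l))) powr a * (1 + s * - (x l ^ Suc k)) powr b
          * (1 + s * kern k (x l) (x l)) powr 1"
      by (intro mult_mono powr_one_plus_ge b1 b2 bk l d mult_nonneg_nonneg) auto
    also have "(1 + s * kern k (x l) (x l)) powr 1 = 1 + s * kern k (x l) (x l)"
      using pos[OF bk[OF l l]] by simp
    finally have le: "exp (s * (a * (x l ^ k * (1 - x l)) - b * x l ^ Suc k + kern k (x l) (x l)) - (\<bar>a\<bar> + \<bar>b\<bar> + 1) * E)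
        \<le> (1 + s * (x l ^ k * (1 - x l))) powr a * (1 + s * - (x l ^ Suc k)) powr b * (1 + s * kern k (x l) (x l))" .
    have "flow k s (x l) powr a = x l powr a * (1 + s * (x l ^ k * (1 - x l))) powr a"
      unfolding flow1 by (rule powr_mult)
    moreover have "(1 - flow k s (x l)) powr b = (1 - x l) powr b * (1 + s * - (x l ^ Suc k)) powr b"
      unfolding flow2 by (rule powr_mult)
    ultimately have "flow k s (x l) powr a * (1 - flow k s (x l)) powr b * (1 + s * kern k (x l) (x l))
       = (x l powr a * (1 - x l) powr b) * ((1 + s * (x l ^ k * (1 - x l))) powr a
           * (1 + s * - (x l ^ Suc k)) powr b * (1 + s * kern k (x l) (x l)))"
      by (simp only: ac_simps)
    with mult_left_mono[OF le, of "x l powr a * (1 - x l) powr b"] show ?thesis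
      by (simp only: mult_nonneg_nonneg powr_ge_zero simp_thms)
  qed
  let ?e1 = "\<lambda>j i. s * (\<beta> * kern k (x j) (x i)) - \<beta> * E"
  let ?e2 = "\<lambda>l. s * (a * (x l ^ k * (1 - x l)) - b * x l ^ Suc k + kern k (x l) (x l)) - (\<bar>a\<bar> + \<bar>b\<bar> + 1) * E"
  have "(\<Sum>j\<in>{1..N}. \<Sum>i\<in>{1..<j}. \<beta> * E) \<le> (\<Sum>j\<in>{1..N}. \<Sum>i\<in>{1..N}. \<beta> * E)"
    using \<open>\<beta> \<ge> 0\<close> E by (intro sum_mono sum_mono2) auto
  moreover have "(\<Sum>j\<in>{1..N}. \<Sum>i\<in>{1..<j}. ?e1 j i)
      = s * (\<Sum>j\<in>{1..N}. \<Sum>i\<in>{1..<j}. \<beta> * kern k (x j) (x i)) - (\<Sum>j\<in>{1..N}. \<Sum>i\<in>{1..<j}. \<beta> * E)"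
    by (simp only: sum_subtractf sum_distrib_left)
  moreover have "(\<Sum>l\<in>{1..N}. ?e2 l)
      = s * (\<Sum>l\<in>{1..N}. a * (x l ^ k * (1 - x l)) - b * x l ^ Suc k + kern k (x l) (x l))
        - real N * ((\<bar>a\<bar> + \<bar>b\<bar> + 1) * E)"
    by (subst sum_subtractf) (simp add: sum_distrib_left)
  moreover have "(\<Sum>j\<in>{1..N}. \<Sum>i\<in>{1..N}. \<beta> * E) = E * (real N * (\<beta> * real N))"
    by simp
  ultimately have "s * loop_sum a b \<beta> k N x - E * (real N * (\<beta> * real N + \<bar>a\<bar> + \<bar>b\<bar> + 1))
      \<le> (\<Sum>j\<in>{1..N}. \<Sum>i\<in>{1..<j}. ?e1 j i) + (\<Sum>l\<in>{1..N}. ?e2 l)"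
    unfolding loop_sum_def by (simp only: distrib_left distrib_right) (simp add: ac_simps)
  then have "exp (s * loop_sum a b \<beta> k N x - E * (real N * (\<beta> * real N + \<bar>a\<bar> + \<bar>b\<bar> + 1)))
      \<le> (\<Prod>j\<in>{1..N}. \<Prod>i\<in>{1..<j}. exp (?e1 j i)) * (\<Prod>l\<in>{1..N}. exp (?e2 l))"
    by (simp only: exp_sum[symmetric] finite_atLeastAtMost finite_atLeastLessThan exp_add[symmetric] exp_le_cancel_iff)
  then have "beta_jacobi_weight a b \<beta> N x * exp (s * loop_sum a b \<beta> k N x - E * (real N * (\<beta> * real N + \<bar>a\<bar> + \<bar>b\<bar> + 1)))
      \<le> beta_jacobi_weight a b \<beta> N x * ((\<Prod>j\<in>{1..N}. \<Prod>i\<in>{1..<j}. exp (?e1 j i)) * (\<Prod>l\<in>{1..N}. exp (?e2 l)))"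
    by (rule mult_left_mono) (auto simp: beta_jacobi_weight_def intro!: mult_nonneg_nonneg prod_nonneg)
  also have "\<dots> = (\<Prod>j\<in>{1..N}. \<Prod>i\<in>{1..<j}. \<bar>x j - x i\<bar> powr \<beta> * exp (?e1 j i))
      * (\<Prod>l\<in>{1..N}. x l powr a * (1 - x l) powr b * exp (?e2 l))"
    using x by (simp add: beta_jacobi_weight_def prod.distrib)
  also have "\<dots> \<le> (\<Prod>j\<in>{1..N}. \<Prod>i\<in>{1..<j}. \<bar>flow k s (x j) - flow k s (x i)\<bar> powr \<beta>)
      * (\<Prod>l\<in>{1..N}. flow k s (x l) powr a * (1 - flow k s (x l)) powr b * (1 + s * kern k (x l) (x l)))"
  proof (rule mult_mono)
    show "(\<Prod>j\<in>{1..N}. \<Prod>i\<in>{1..<j}. \<bar>x j - x i\<bar> powr \<beta> * exp (?e1 j i))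
        \<le> (\<Prod>j\<in>{1..N}. \<Prod>i\<in>{1..<j}. \<bar>flow k s (x j) - flow k s (x i)\<bar> powr \<beta>)"
      by (intro prod_mono conjI prod_nonneg pair) auto
    show "(\<Prod>l\<in>{1..N}. x l powr a * (1 - x l) powr b * exp (?e2 l))
        \<le> (\<Prod>l\<in>{1..N}. flow k s (x l) powr a * (1 - flow k s (x l)) powr b * (1 + s * kern k (x l) (x l)))"
      by (intro prod_mono conjI single) auto
  qed (auto intro!: prod_nonneg)
  also have "\<dots> = beta_jacobi_weight a b \<beta> N (\<lambda>i\<in>{1..N}. flow k s (x i)) * (\<Prod>l\<in>{1..N}. 1 + s * kern k (x l) (x l))"
    using flow01 by (auto simp: beta_jacobi_weight_def prod.distrib intro!: arg_cong2[where f = "(*)"] prod.cong)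
  finally show ?thesis by (simp add: E_def d_def)
qed

section \<open>The quadratic recursion for the moments\<close>

lemma sum_square_symmetric:
  fixes h :: "nat \<Rightarrow> nat \<Rightarrow> real"
  assumes sym: "\<And>i j. h i j = h j i"
  shows "(\<Sum>j\<in>{1..N}. \<Sum>i\<in>{1..N}. h j i) = 2 * (\<Sum>j\<in>{1..N}. \<Sum>i\<in>{1..<j}. h j i) + (\<Sum>j\<in>{1..N}. h j j)"
proof (induction N)
  case (Suc N)
  have "{1..<Suc N} = {1..N}" by auto
  moreover have "(\<Sum>j\<in>{1..N}. h j (Suc N)) = (\<Sum>j\<in>{1..N}. h (Suc N) j)"
    by (intro sum.cong refl sym)
  ultimately show ?case
    using Suc by (simp add: sum.distrib)
qed simp

definition power_mean :: "nat \<Rightarrow> (nat \<Rightarrow> real) \<Rightarrow> nat \<Rightarrow> real" where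
  "power_mean N x p = (\<Sum>i\<in>{1..N}. x i ^ p) / real N"

text \<open>The sum over all ordered pairs is a convolution of power means. Removing the diagonal
  and halving gives the pair sum; the diagonal is also the derivative term, whence the factor
  \<open>1 - \<beta> / 2\<close>.\<close>

lemma loop_sum_power_mean:
  fixes x :: "nat \<Rightarrow> real"
  assumes "N \<ge> 1"
  defines "S \<equiv> power_mean N x"
  shows "loop_sum a b \<beta> k N x / real N
    = \<beta> * real N / 2 * ((\<Sum>p\<le>k. S p * S (k - p)) - (\<Sum>p\<le>Suc k. S p * S (Suc k - p)))
      + (1 - \<beta> / 2) * ((real k + 1) * S k - (real k + 2) * S (Suc k))
      + a * (S k - S (Suc k)) - b * S (Suc k)"
proof -
  have N: "real N > 0" using assms(1) by simp
  have S: "(\<Sum>i\<in>{1..N}. x i ^ p) = real N * S p" for p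
    using N by (simp add: S_def power_mean_def)
  have conv: "(\<Sum>j\<in>{1..N}. \<Sum>i\<in>{1..N}. \<Sum>p\<le>n. x j ^ p * x i ^ (n - p)) = (real N)\<^sup>2 * (\<Sum>p\<le>n. S p * S (n - p))" for n
  proof -
    have "(\<Sum>j\<in>{1..N}. \<Sum>i\<in>{1..N}. \<Sum>p\<le>n. x j ^ p * x i ^ (n - p))
        = (\<Sum>p\<le>n. \<Sum>j\<in>{1..N}. \<Sum>i\<in>{1..N}. x j ^ p * x i ^ (n - p))"
      by (subst (2) sum.swap, subst sum.swap) (rule refl)
    also have "\<dots> = (\<Sum>p\<le>n. (real N)\<^sup>2 * (S p * S (n - p)))"
      unfolding sum_product[symmetric] S by (simp add: power2_eq_square ac_simps)
    finally show ?thesis by (simp add: sum_distrib_left)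
  qed
  have diag: "(\<Sum>l\<in>{1..N}. kern k (x l) (x l)) = real N * ((real k + 1) * S k - (real k + 2) * S (Suc k))"
    unfolding kern_diag sum_subtractf sum_distrib_left[symmetric] S by (simp add: algebra_simps)
  have "(\<Sum>j\<in>{1..N}. \<Sum>i\<in>{1..N}. kern k (x j) (x i))
      = (real N)\<^sup>2 * ((\<Sum>p\<le>k. S p * S (k - p)) - (\<Sum>p\<le>Suc k. S p * S (Suc k - p)))"
    unfolding kern_def sum_subtractf conv right_diff_distrib ..
  with sum_square_symmetric[of "\<lambda>j i. kern k (x j) (x i)" N]
  have "(\<Sum>j\<in>{1..N}. \<Sum>i\<in>{1..<j}. kern k (x j) (x i))
      = ((real N)\<^sup>2 * ((\<Sum>p\<le>k. S p * S (k - p)) - (\<Sum>p\<le>Suc k. S p * S (Suc k - p)))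
         - real N * ((real k + 1) * S k - (real k + 2) * S (Suc k))) / 2"
    unfolding diag by (simp add: kern_commute)
  moreover have "(\<Sum>l\<in>{1..N}. a * (x l ^ k * (1 - x l)) - b * x l ^ Suc k + kern k (x l) (x l))
      = a * (real N * S k - real N * S (Suc k)) - b * (real N * S (Suc k))
        + real N * ((real k + 1) * S k - (real k + 2) * S (Suc k))"
  proof -
    have "x l ^ k * (1 - x l) = x l ^ k - x l ^ Suc k" for l by (simp add: algebra_simps)
    then show ?thesis
      by (simp only: sum.distrib sum_subtractf sum_distrib_left[symmetric] S diag)
  qed
  ultimately show ?thesis
    using N unfolding loop_sum_def sum_distrib_left[symmetric]
    by (simp only:) (simp add: field_simps power2_eq_square)
qed

text \<open>The loop equation can be solved for its highest power mean, so convergence follows by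
  strong induction; passing to the limit in it then gives the recursion that identifies the
  limits.\<close>

lemma power_means_converge:
  fixes x :: "nat \<Rightarrow> nat \<Rightarrow> real"
  assumes abc: "a > -1" "b > -1" "c \<ge> 0"
    and \<beta>: "(\<lambda>N. \<beta> N * real N) \<longlonglongrightarrow> 2 * c"
    and loop: "\<And>k. (\<lambda>N. loop_sum a b (\<beta> N) k N (x N) / real N) \<longlonglongrightarrow> 0"
  shows "(\<lambda>N. power_mean N (x N) k) \<longlonglongrightarrow> imat_power (J_mat a b c) k 0 0"
proof -
  define S where "S N = power_mean N (x N)" for N
  define T where "T n N = (\<Sum>p\<le>n. S N p * S N (n - p))" for n N
  \<comment> \<open>Only eventually: for N = 0 the quotient is 0 / 0 = 0.\<close>
  have S0: "\<forall>\<^sub>F N in sequentially. S N 0 = 1"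
    using eventually_ge_at_top[of 1] by eventually_elim (simp add: S_def power_mean_def)
  have \<beta>0: "\<beta> \<longlonglongrightarrow> 0"
  proof -
    have "(\<lambda>N. \<beta> N * real N * inverse (real N)) \<longlonglongrightarrow> 2 * c * 0"
      by (intro tendsto_mult \<beta> lim_inverse_n)
    moreover have "\<forall>\<^sub>F N in sequentially. \<beta> N * real N * inverse (real N) = \<beta> N"
      using eventually_gt_at_top[of 0] by eventually_elim simp
    ultimately show ?thesis
      using tendsto_cong[of "\<lambda>N. \<beta> N * real N * inverse (real N)" \<beta> sequentially 0] by simp
  qed
  have loop_eq: "\<forall>\<^sub>F N in sequentially. loop_sum a b (\<beta> N) k N (x N) / real N
      = \<beta> N * real N / 2 * (T k N - T (Suc k) N)
      + (1 - \<beta> N / 2) * ((real k + 1) * S N k - (real k + 2) * S N (Suc k))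
      + a * (S N k - S N (Suc k)) - b * S N (Suc k)" for k
    using eventually_ge_at_top[of 1]
    by eventually_elim (simp only: loop_sum_power_mean S_def T_def)
  have conv: "convergent (\<lambda>N. S N k)" for k
  proof (induction k rule: less_induct)
    case (less k)
    show ?case
    proof (cases k)
      case 0
      then show ?thesis
        using tendsto_eventually[OF S0] by (auto simp: convergent_def)
    next
      case (Suc n)
      define l where "l p = lim (\<lambda>N. S N p)" for p
      have l: "(\<lambda>N. S N p) \<longlonglongrightarrow> l p" if "p \<le> n" for p
        using less[of p] that Suc by (simp add: l_def convergent_LIMSEQ_iff)
      \<comment> \<open>The end terms of the convolution \<open>T (Suc n)\<close> contribute
        \<open>2 * S N (Suc n)\<close>, as \<open>S N 0 = 1\<close>. So \<open>S N (Suc n)\<close>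
        occurs linearly, with coefficient \<open>den\<close>, whose limit is positive because
        \<open>a + b > -2\<close>.\<close>
      define den where "den N = \<beta> N * real N + (1 - \<beta> N / 2) * (real n + 2) + a + b" for N
      define num where "num N = \<beta> N * real N / 2 * (T n N - (\<Sum>p\<in>{1..n}. S N p * S N (Suc n - p)))
        + (1 - \<beta> N / 2) * ((real n + 1) * S N n) + a * S N n
        - loop_sum a b (\<beta> N) n N (x N) / real N" for N
      have den: "den \<longlonglongrightarrow> 2 * c + (1 - 0 / 2) * (real n + 2) + a + b"
        unfolding den_def by (intro tendsto_intros \<beta> \<beta>0) simp
      have den_pos: "2 * c + (1 - 0 / 2) * (real n + 2) + a + b > 0"
        using abc by simp
      have num: "num \<longlonglongrightarrow> 2 * c / 2 * ((\<Sum>p\<le>n. l p * l (n - p)) - (\<Sum>p\<in>{1..n}. l p * l (Suc n - p)))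
        + (1 - 0 / 2) * ((real n + 1) * l n) + a * l n - 0"
        unfolding num_def T_def by (intro tendsto_intros \<beta> \<beta>0 loop l) auto
      have "\<forall>\<^sub>F N in sequentially. num N / den N = S N k"
        using loop_eq[of n] S0 order_tendstoD(1)[OF den den_pos]
      proof eventually_elim
        case (elim N)
        have "{..Suc n} = insert 0 (insert (Suc n) {1..n})" by auto
        then have "T (Suc n) N = 2 * S N (Suc n) + (\<Sum>p\<in>{1..n}. S N p * S N (Suc n - p))"
          using elim(2) by (simp add: T_def)
        moreover have "u / 2 * (t - r) + w * (y * s) + a * s
            - (u / 2 * (t - (2 * q + r)) + w * (y * s - z * q) + a * (s - q) - b * q)
            = (u + w * z + a + b) * q" for u t r w y s q z :: real
          by (simp add: field_simps)
        ultimately have "num N = den N * S N (Suc n)"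
          unfolding num_def den_def elim(1) by (simp only:)
        with elim(3) Suc show ?case by simp
      qed
      with tendsto_divide[OF num den] den_pos show ?thesis
        by (intro convergentI) (rule Lim_transform_eventually, auto)
    qed
  qed
  define m where "m k = lim (\<lambda>N. S N k)" for k
  have m: "(\<lambda>N. S N k) \<longlonglongrightarrow> m k" for k
    using conv[of k] by (simp add: m_def convergent_LIMSEQ_iff)
  have m0: "m 0 = 1"
    using LIMSEQ_unique[OF m[of 0] tendsto_eventually[OF S0]] .
  have rec: "(real k + 1 + a) * m k - (real k + 2 + a + b) * m (Suc k)
        + c * ((\<Sum>p\<le>k. m p * m (k - p)) - (\<Sum>p\<le>Suc k. m p * m (Suc k - p))) = 0" for k
  proof -
    have "(\<lambda>N. \<beta> N * real N / 2 * (T k N - T (Suc k) N)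
      + (1 - \<beta> N / 2) * ((real k + 1) * S N k - (real k + 2) * S N (Suc k))
      + a * (S N k - S N (Suc k)) - b * S N (Suc k)) \<longlonglongrightarrow>
      2 * c / 2 * ((\<Sum>p\<le>k. m p * m (k - p)) - (\<Sum>p\<le>Suc k. m p * m (Suc k - p)))
      + (1 - 0 / 2) * ((real k + 1) * m k - (real k + 2) * m (Suc k))
      + a * (m k - m (Suc k)) - b * m (Suc k)" (is "_ \<longlonglongrightarrow> ?lim")
      unfolding T_def by (intro tendsto_intros \<beta> \<beta>0 m) auto
    then have "(\<lambda>N. loop_sum a b (\<beta> N) k N (x N) / real N) \<longlonglongrightarrow> ?lim"
      using tendsto_cong[OF loop_eq[of k]] by simp
    then have "?lim = 0"
      using LIMSEQ_unique loop by blast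
    moreover have "2 * c / 2 * (P - Q) + (1 - 0 / 2) * (y * u - z * v) + a * (u - v) - b * v
        = (y + a) * u - (z + a + b) * v + c * (P - Q)" for P Q u v y z
      by (simp add: algebra_simps)
    ultimately show ?thesis by (simp only:)
  qed
  have "imat_power (J_mat a b c) k 0 0 = m k"
    by (rule J_mat_power_00[OF abc m0 rec])
  with m[of k] show ?thesis by (simp add: S_def)
qed

section \<open>Exponential concentration\<close>

lemma loop_sum_measurable [measurable]:
  "loop_sum a b \<beta> k N \<in> borel_measurable (\<Pi>\<^sub>M i\<in>{1..N}. lborel)"
proof -
  have coord: "(\<lambda>x. x i) \<in> borel_measurable (\<Pi>\<^sub>M i\<in>{1..N}. (lborel :: real measure))" if "i \<in> {1..N}" for i
    using measurable_component_singleton[OF that, of "\<lambda>_. lborel :: real measure"] by simp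
  show ?thesis
    unfolding loop_sum_def[abs_def]
    by (intro borel_measurable_add borel_measurable_sum borel_measurable_times borel_measurable_diff
          borel_measurable_power borel_measurable_const kern_measurable coord) auto
qed

lemma beta_jacobi_density_measurable [measurable]:
  "beta_jacobi_density a b \<beta> N \<in> borel_measurable (\<Pi>\<^sub>M i\<in>{1..N}. lborel)"
  unfolding beta_jacobi_density_def[abs_def]
  using beta_jacobi_weight_measurable[measurable] by measurable

text \<open>
  Under \<open>x \<mapsto> flow k s x\<close> the total mass is preserved while the density is multiplied by at
  least \<open>exp (s * loop_sum - O(N s\<^sup>2))\<close>, which makes this exponential moment at most \<open>exp (O(N s\<^sup>2))\<close>.
\<close>

lemma nn_integral_exp_loop_sum_le:
  fixes a b \<beta> s :: real and k N :: nat
  assumes s: "\<bar>s\<bar> * (real k + 2) \<le> 1 / 2" and "\<beta> \<ge> 0"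
  defines "Q \<equiv> 2 * (\<bar>s\<bar> * (real k + 2))\<^sup>2 * (real N * (\<beta> * real N + \<bar>a\<bar> + \<bar>b\<bar> + 1))"
    and "P \<equiv> \<Pi>\<^sub>M i\<in>{1..N}. (lborel :: real measure)"
  shows "(\<integral>\<^sup>+x. beta_jacobi_density a b \<beta> N x * ennreal (exp (s * loop_sum a b \<beta> k N x - Q)) \<partial>P)
       \<le> (\<integral>\<^sup>+x. beta_jacobi_density a b \<beta> N x \<partial>P)"
proof -
  let ?f = "beta_jacobi_density a b \<beta> N"
  let ?w = "\<lambda>x. ennreal (1 + s * kern k x x) * indicator {0..1} x"
  have "?f x * ennreal (exp (s * loop_sum a b \<beta> k N x - Q))
      \<le> ?f (\<lambda>i\<in>{1..N}. flow k s (x i)) * (\<Prod>i\<in>{1..N}. ?w (x i))" for x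
  proof (cases "\<forall>i\<in>{1..N}. 0 < x i \<and> x i < 1")
    case False
    then show ?thesis by (auto simp: beta_jacobi_density_def beta_jacobi_weight_def)
  next
    case True
    have nonneg: "1 + s * kern k (x i) (x i) \<ge> 0" if "i \<in> {1..N}" for i
    proof -
      have "\<bar>s * kern k (x i) (x i)\<bar> \<le> \<bar>s\<bar> * (real k + 2)"
        unfolding abs_mult using True that by (intro mult_left_mono abs_kern_le) (auto intro: less_imp_le)
      with s show ?thesis by linarith
    qed
    have "(\<Prod>i\<in>{1..N}. ?w (x i)) = (\<Prod>i\<in>{1..N}. ennreal (1 + s * kern k (x i) (x i)))"
      using True by (intro prod.cong) (auto simp: less_imp_le)
    also have "\<dots> = ennreal (\<Prod>i\<in>{1..N}. 1 + s * kern k (x i) (x i))"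
      using nonneg by (intro prod_ennreal) auto
    finally have prod: "(\<Prod>i\<in>{1..N}. ?w (x i)) = ennreal (\<Prod>i\<in>{1..N}. 1 + s * kern k (x i) (x i))" .
    have nn: "beta_jacobi_weight a b \<beta> N y \<ge> 0" for y
      by (auto simp: beta_jacobi_weight_def intro!: mult_nonneg_nonneg prod_nonneg)
    have "beta_jacobi_weight a b \<beta> N x * exp (s * loop_sum a b \<beta> k N x - Q)
        \<le> beta_jacobi_weight a b \<beta> N (\<lambda>i\<in>{1..N}. flow k s (x i)) * (\<Prod>i\<in>{1..N}. 1 + s * kern k (x i) (x i))"
      unfolding Q_def by (rule beta_jacobi_weight_flow[OF _ s \<open>\<beta> \<ge> 0\<close>]) (use True in blast)
    then have "ennreal (beta_jacobi_weight a b \<beta> N x) * ennreal (exp (s * loop_sum a b \<beta> k N x - Q))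
        \<le> ennreal (beta_jacobi_weight a b \<beta> N (\<lambda>i\<in>{1..N}. flow k s (x i)))
           * ennreal (\<Prod>i\<in>{1..N}. 1 + s * kern k (x i) (x i))"
      using ennreal_leI by (simp only: ennreal_mult[OF nn exp_ge_zero, symmetric] ennreal_mult[OF nn prod_nonneg[OF nonneg], symmetric])
    \<comment> \<open>Both sides carry the same normalising factor, and division by it is monotone
      in \<open>ennreal\<close>.\<close>
    from divide_right_mono_ennreal[OF this, of "beta_jacobi_Z a b \<beta> N"] show ?thesis
      unfolding prod beta_jacobi_density_def divide_ennreal_def by (simp only: ac_simps)
  qed
  then have "(\<integral>\<^sup>+x. ?f x * ennreal (exp (s * loop_sum a b \<beta> k N x - Q)) \<partial>P)
      \<le> (\<integral>\<^sup>+x. ?f (\<lambda>i\<in>{1..N}. flow k s (x i)) * (\<Prod>i\<in>{1..N}. ?w (x i)) \<partial>P)"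
    by (intro nn_integral_mono)
  \<comment> \<open>The change of variables removes the Jacobian and leaves the indicator of the
    cube, which is at most 1.\<close>
  also have "\<dots> = (\<integral>\<^sup>+x. ?f x * (\<Prod>i\<in>{1..N}. indicator {0..1} (x i)) \<partial>P)"
    unfolding P_def using nn_integral_flow[OF s]
    by (intro nn_integral_PiM_componentwise beta_jacobi_density_measurable) (auto intro!: flow_measurable kern_measurable)
  also have "\<dots> \<le> (\<integral>\<^sup>+x. ?f x * 1 \<partial>P)"
    by (intro nn_integral_mono mult_left_mono prod_le_1) (auto split: split_indicator)
  finally show ?thesis by simp
qed

text \<open>Chernoff's bound: \<open>exp (s * loop_sum - t)\<close> is at least 1 on the event, and
  its integral is controlled by the preceding lemma.\<close>

lemma (in prob_space) prob_loop_sum_ge: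
  assumes D: "distributed M (\<Pi>\<^sub>M i\<in>{1..N}. lborel) X (beta_jacobi_density a b \<beta> N)"
    and s: "\<bar>s\<bar> * (real k + 2) \<le> 1 / 2" and "\<beta> \<ge> 0"
  shows "prob {\<omega>\<in>space M. t \<le> s * loop_sum a b \<beta> k N (X \<omega>)}
       \<le> exp (2 * (\<bar>s\<bar> * (real k + 2))\<^sup>2 * (real N * (\<beta> * real N + \<bar>a\<bar> + \<bar>b\<bar> + 1)) - t)"
proof -
  let ?P = "\<Pi>\<^sub>M i\<in>{1..N}. (lborel :: real measure)"
  let ?f = "beta_jacobi_density a b \<beta> N" and ?L = "loop_sum a b \<beta> k N"
  define Q where "Q = 2 * (\<bar>s\<bar> * (real k + 2))\<^sup>2 * (real N * (\<beta> * real N + \<bar>a\<bar> + \<bar>b\<bar> + 1))"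
  define A where "A = {x\<in>space ?P. t \<le> s * ?L x}"
  have A [measurable]: "A \<in> sets ?P" unfolding A_def by measurable
  have X: "X \<in> measurable M ?P" by (rule distributed_measurable[OF D])
  \<comment> \<open>The total mass is read off from \<open>X\<close> having this density, without
    evaluating the Selberg integral.\<close>
  have "(\<integral>\<^sup>+x. ?f x \<partial>?P) = (\<integral>\<^sup>+x. ?f x * indicator (space ?P) x \<partial>?P)"
    by (intro nn_integral_cong) simp
  also have "\<dots> = emeasure M (X -` space ?P \<inter> space M)"
    by (rule distributed_emeasure[OF D, symmetric]) simp
  also have "\<dots> \<le> 1" by (rule emeasure_le_1)
  finally have mass: "(\<integral>\<^sup>+x. ?f x \<partial>?P) \<le> 1" .
  have "{\<omega>\<in>space M. t \<le> s * ?L (X \<omega>)} = X -` A \<inter> space M"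
    using measurable_space[OF X] by (auto simp: A_def)
  then have "emeasure M {\<omega>\<in>space M. t \<le> s * ?L (X \<omega>)} = (\<integral>\<^sup>+x. ?f x * indicator A x \<partial>?P)"
    using distributed_emeasure[OF D A] by simp
  also have "\<dots> \<le> (\<integral>\<^sup>+x. ennreal (exp (Q - t)) * (?f x * ennreal (exp (s * ?L x - Q))) \<partial>?P)"
  proof (rule nn_integral_mono)
    fix x
    have "indicator A x \<le> ennreal (exp (Q - t) * exp (s * ?L x - Q))"
      by (auto simp: A_def exp_add[symmetric] split: split_indicator)
    then have "?f x * indicator A x \<le> ?f x * ennreal (exp (Q - t) * exp (s * ?L x - Q))"
      by (rule mult_left_mono) simp
    then show "?f x * indicator A x \<le> ennreal (exp (Q - t)) * (?f x * ennreal (exp (s * ?L x - Q)))"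
      by (simp add: ennreal_mult ac_simps)
  qed
  also have "\<dots> = ennreal (exp (Q - t)) * (\<integral>\<^sup>+x. ?f x * ennreal (exp (s * ?L x - Q)) \<partial>?P)"
    by (rule nn_integral_cmult) measurable
  also have "\<dots> \<le> ennreal (exp (Q - t)) * 1"
    using nn_integral_exp_loop_sum_le[OF s \<open>\<beta> \<ge> 0\<close>, where a = a and b = b and N = N] mass
    by (intro mult_left_mono) (auto simp: Q_def intro: order_trans)
  finally show ?thesis
    unfolding Q_def[symmetric] by (simp add: emeasure_eq_measure)
qed

text \<open>Taking \<open>s\<close> to be plus and minus a fixed \<open>r\<close> gives a geometric
  bound on both tails, so Borel-Cantelli applies for each \<epsilon>.\<close>

lemma (in prob_space) AE_loop_sum_tendsto_0:
  fixes lam :: "nat \<Rightarrow> 'a \<Rightarrow> nat \<Rightarrow> real"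
  assumes \<beta>: "\<And>N. N \<ge> 1 \<Longrightarrow> \<beta> N > 0" and Bseq: "Bseq (\<lambda>N. \<beta> N * real N)"
    and D: "\<And>N. N \<ge> 1 \<Longrightarrow>
           distributed M (\<Pi>\<^sub>M i\<in>{1..N}. lborel) (lam N) (beta_jacobi_density a b (\<beta> N) N)"
  shows "AE \<omega> in M. (\<lambda>N. loop_sum a b (\<beta> N) k N (lam N \<omega>) / real N) \<longlonglongrightarrow> 0"
proof -
  let ?L = "\<lambda>N \<omega>. loop_sum a b (\<beta> N) k N (lam N \<omega>)"
  obtain B where "B > 0" and abs_B: "\<And>N. \<bar>\<beta> N * real N\<bar> \<le> B"
    using BseqE[OF Bseq] by auto
  have B: "\<beta> N * real N \<le> B" for N
    using abs_B[of N] by linarith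
  \<comment> \<open>With \<open>\<bar>s\<bar> = r\<close> the quadratic error in the exponent is at
    most \<open>real N * r * (r * K)\<close>.\<close>
  define K where "K = 2 * (real k + 2)\<^sup>2 * (B + \<bar>a\<bar> + \<bar>b\<bar> + 1)"
  have K: "K > 0" using \<open>B > 0\<close> by (auto simp: K_def intro!: mult_pos_pos)
  have "AE \<omega> in M. \<forall>\<^sub>F N in sequentially. \<bar>?L N \<omega> / real N\<bar> < \<epsilon>" if "\<epsilon> > 0" for \<epsilon>
  proof -
    \<comment> \<open>The first bound makes \<open>r\<close> admissible for \<open>flow\<close>; the
      second keeps the quadratic error below half of the linear gain
      \<open>r * \<epsilon> * real N\<close>.\<close>
    define r where "r = min (1 / (2 * (real k + 2))) (\<epsilon> / (2 * K))"
    have r: "r > 0" using that K by (simp add: r_def)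
    have half: "e / (2 * y) * y = e / 2" if "y > 0" for e y :: real
      using that by simp
    have "r * (real k + 2) \<le> 1 / (2 * (real k + 2)) * (real k + 2)" "r * K \<le> \<epsilon> / (2 * K) * K"
      unfolding r_def using K by (intro mult_right_mono; simp)+
    moreover have "real k + 2 > 0" by simp
    ultimately have rk: "r * (real k + 2) \<le> 1 / 2" and rK: "r * K \<le> \<epsilon> / 2"
      using K by (simp_all only: half)
    define q where "q = exp (- (r * \<epsilon> / 2))"
    have q: "0 < q" "q < 1" using r that by (auto simp: q_def)
    have tail: "prob {\<omega>\<in>space M. r * \<epsilon> * real N \<le> s * ?L N \<omega>} \<le> q ^ N" if N: "N \<ge> 1" and s: "\<bar>s\<bar> = r" for N s
    proof -
      have "prob {\<omega>\<in>space M. r * \<epsilon> * real N \<le> s * ?L N \<omega>}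
          \<le> exp (2 * (\<bar>s\<bar> * (real k + 2))\<^sup>2 * (real N * (\<beta> N * real N + \<bar>a\<bar> + \<bar>b\<bar> + 1)) - r * \<epsilon> * real N)"
        using rk s \<beta>[OF N] by (intro prob_loop_sum_ge D N) auto
      also have "\<dots> \<le> exp (2 * (r * (real k + 2))\<^sup>2 * (real N * (B + \<bar>a\<bar> + \<bar>b\<bar> + 1)) - r * \<epsilon> * real N)"
        unfolding s exp_le_cancel_iff
        by (intro diff_right_mono mult_left_mono add_right_mono B) auto
      also have "2 * (r * (real k + 2))\<^sup>2 * (real N * (B + \<bar>a\<bar> + \<bar>b\<bar> + 1)) = real N * r * (r * K)"
        by (simp only: K_def power_mult_distrib power2_eq_square ac_simps)
      also have "exp (real N * r * (r * K) - r * \<epsilon> * real N) \<le> exp (real N * r * (\<epsilon> / 2) - r * \<epsilon> * real N)"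
        unfolding exp_le_cancel_iff using r by (intro diff_right_mono mult_left_mono rK) auto
      also have "\<dots> = q ^ N"
        by (simp add: q_def exp_of_nat_mult[symmetric] algebra_simps)
      finally show ?thesis .
    qed
    \<comment> \<open>Indexed by \<open>Suc N\<close>, since the ensembles are given from N = 1
      on.\<close>
    define A where "A N = {\<omega>\<in>space M. r * \<epsilon> * real (Suc N) \<le> r * ?L (Suc N) \<omega>}
        \<union> {\<omega>\<in>space M. r * \<epsilon> * real (Suc N) \<le> - r * ?L (Suc N) \<omega>}" for N
    have meas: "(\<lambda>\<omega>. ?L (Suc N) \<omega>) \<in> borel_measurable M" for N
      using measurable_compose[OF distributed_measurable[OF D[of "Suc N"]] loop_sum_measurable] by simp
    have A_sets: "A N \<in> sets M" for N
      using meas[measurable] unfolding A_def by measurable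
    have "prob (A N) \<le> q ^ Suc N + q ^ Suc N" for N
      unfolding A_def using meas[measurable] tail[of "Suc N" r] tail[of "Suc N" "- r"] r
      by (intro order_trans[OF measure_Un_le] add_mono) (auto intro: less_imp_le)
    then have bound: "norm (prob (A N)) \<le> 2 * q * q ^ N" for N
      by (simp add: mult.assoc)
    have "summable (\<lambda>N. 2 * q * q ^ N)"
      using q by (intro summable_mult summable_geometric) simp
    then have "summable (\<lambda>N. prob (A N))"
      by (rule summable_comparison_test'[where N = 0]) (rule bound)
    then have "AE \<omega> in M. \<forall>\<^sub>F N in sequentially. \<omega> \<in> space M - A N"
      by (intro borel_cantelli_AE1 A_sets) (auto simp: emeasure_eq_measure)
    then show ?thesis
    proof (rule eventually_mono)
      fix \<omega> assume "\<forall>\<^sub>F N in sequentially. \<omega> \<in> space M - A N"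
      then have "\<forall>\<^sub>F N in sequentially. \<bar>?L (Suc N) \<omega> / real (Suc N)\<bar> < \<epsilon>"
      proof eventually_elim
        case (elim N)
        then have "r * ?L (Suc N) \<omega> < r * (\<epsilon> * real (Suc N))" "r * (- ?L (Suc N) \<omega>) < r * (\<epsilon> * real (Suc N))"
          by (auto simp: A_def not_le mult.assoc)
        then have "?L (Suc N) \<omega> < \<epsilon> * real (Suc N)" "- ?L (Suc N) \<omega> < \<epsilon> * real (Suc N)"
          using r by (simp_all only: mult_less_cancel_left_pos)
        then show ?case by (simp add: abs_less_iff divide_less_eq del: of_nat_Suc)
      qed
      then show "\<forall>\<^sub>F N in sequentially. \<bar>?L N \<omega> / real N\<bar> < \<epsilon>"
        by (simp only: eventually_sequentially_Suc[of "\<lambda>N. \<bar>?L N \<omega> / real N\<bar> < \<epsilon>"])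
    qed
  qed
  \<comment> \<open>Countably many tolerances, so that one null set serves all of them.\<close>
  then have "AE \<omega> in M. \<forall>m. \<forall>\<^sub>F N in sequentially. \<bar>?L N \<omega> / real N\<bar> < inverse (real (Suc m))"
    by (simp add: AE_all_countable)
  then show ?thesis
  proof (rule eventually_mono)
    fix \<omega>
    assume ev: "\<forall>m. \<forall>\<^sub>F N in sequentially. \<bar>?L N \<omega> / real N\<bar> < inverse (real (Suc m))"
    show "(\<lambda>N. ?L N \<omega> / real N) \<longlonglongrightarrow> 0"
    proof (rule tendstoI)
      fix e :: real assume "e > 0"
      obtain m where m: "inverse (real (Suc m)) < e"
        using reals_Archimedean[OF \<open>e > 0\<close>] by blast
      show "\<forall>\<^sub>F N in sequentially. dist (?L N \<omega> / real N) 0 < e"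
        using ev[rule_format, of m] by eventually_elim (use m in \<open>simp add: dist_real_def\<close>)
    qed
  qed
qed

section \<open>From almost sure loop equations to weak convergence\<close>

lemma (in prob_space) AE_beta_jacobi_unit_interval:
  assumes D: "distributed M (\<Pi>\<^sub>M i\<in>{1..N}. lborel) X (beta_jacobi_density a b \<beta> N)"
  shows "AE \<omega> in M. \<forall>i\<in>{1..N}. X \<omega> i \<in> {0..1}"
proof -
  let ?P = "\<Pi>\<^sub>M i\<in>{1..N}. (lborel :: real measure)"
  define A where "A = {x\<in>space ?P. \<not> (\<forall>i\<in>{1..N}. x i \<in> {0..1})}"
  have A [measurable]: "A \<in> sets ?P" unfolding A_def by measurable
  have X: "X \<in> measurable M ?P" by (rule distributed_measurable[OF D])
  have "emeasure M (X -` A \<inter> space M) = (\<integral>\<^sup>+x. beta_jacobi_density a b \<beta> N x * indicator A x \<partial>?P)"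
    by (rule distributed_emeasure[OF D A])
  also have "\<dots> = (\<integral>\<^sup>+x. 0 \<partial>?P)"
    by (intro nn_integral_cong)
       (auto simp: A_def beta_jacobi_density_def beta_jacobi_weight_def less_imp_le split: split_indicator)
  finally have "X -` A \<inter> space M \<in> null_sets M"
    using measurable_sets[OF X A] by (auto simp: null_sets_def)
  then show ?thesis
    by (rule AE_I') (use measurable_space[OF X] in \<open>auto simp: A_def\<close>)
qed

theorem theorem1p1:
  fixes a b c :: real and \<beta> :: "nat \<Rightarrow> real"
    and M :: "'w measure" and lam :: "nat \<Rightarrow> 'w \<Rightarrow> nat \<Rightarrow> real"
  assumes "a > -1" and "b > -1" and "c \<ge> 0"
    and "prob_space M"
    and "\<And>N. N \<ge> 1 \<Longrightarrow> \<beta> N > 0"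
    and "\<And>N. N \<ge> 1 \<Longrightarrow>
           distributed M (\<Pi>\<^sub>M i\<in>{1..N}. lborel) (lam N) (beta_jacobi_density a b (\<beta> N) N)"
    and "(\<lambda>N. \<beta> N * real N) \<longlonglongrightarrow> 2 * c"
  shows "is_spectral_measure (J_mat a b c) (nu_measure a b c) \<and>
         (AE \<omega> in M. weak_conv_m (\<lambda>N. empirical_measure N (lam N \<omega>)) (nu_measure a b c))"
proof -
  interpret prob_space M by fact
  have "AE \<omega> in M. \<forall>N. N \<ge> 1 \<longrightarrow> (\<forall>i\<in>{1..N}. lam N \<omega> i \<in> {0..1})"
    using AE_beta_jacobi_unit_interval[OF assms(6)] by (simp add: AE_all_countable)
  moreover have "AE \<omega> in M. \<forall>k. (\<lambda>N. loop_sum a b (\<beta> N) k N (lam N \<omega>) / real N) \<longlonglongrightarrow> 0"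
    using AE_loop_sum_tendsto_0[OF assms(5) convergent_imp_Bseq[OF convergentI[OF assms(7)]] assms(6)]
    by (simp add: AE_all_countable)
  ultimately have AE: "AE \<omega> in M. is_spectral_measure (J_mat a b c) (nu_measure a b c) \<and>
      weak_conv_m (\<lambda>N. empirical_measure N (lam N \<omega>)) (nu_measure a b c)"
  proof eventually_elim
    case (elim \<omega>)
    \<comment> \<open>Starts at one point, as the empirical measure of no points has total mass 0;
      the shift is undone at the end, in the limits of distribution functions.\<close>
    define \<mu> where "\<mu> N = empirical_measure (Suc N) (lam (Suc N) \<omega>)" for N
    have "real_distribution (\<mu> N)" for N
      unfolding \<mu>_def by (rule real_distribution_empirical_measure) simp
    moreover have "AE x in \<mu> N. x \<in> {0..1}" for N
      unfolding \<mu>_def using elim(1) by (intro AE_empirical_measure) auto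
    moreover have "(\<lambda>N. integral\<^sup>L (\<mu> N) (\<lambda>x. x ^ k)) \<longlonglongrightarrow> imat_power (J_mat a b c) k 0 0" for k
    proof -
      have "(\<lambda>N. power_mean N (lam N \<omega>) k) \<longlonglongrightarrow> imat_power (J_mat a b c) k 0 0"
        using elim(2) by (intro power_means_converge[OF assms(1-3,7)]) auto
      from LIMSEQ_Suc[OF this] show ?thesis
        by (simp add: \<mu>_def integral_empirical_measure power_mean_def)
    qed
    ultimately have "is_spectral_measure (J_mat a b c) (nu_measure a b c)" "weak_conv_m \<mu> (nu_measure a b c)"
      unfolding nu_measure_def by (rule moment_convergence_unit_interval)+
    then show ?case
      unfolding weak_conv_m_def weak_conv_def \<mu>_def by (auto dest: LIMSEQ_imp_Suc)
  qed
  \<comment> \<open>The first conjunct does not depend on \<omega>: holding almost surely on a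
    probability space, it holds.\<close>
  then show ?thesis by simp
qed

end
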